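(* Let $n\ge 2$ and let $w\in R_n=[2^{n-1},2^n-1]$ be an integer with binary representation $w=b_1b_2\cdots b_n$ (so $b_1=1$), and let $B=b_2b_3\cdots b_{n-1}$ be its internal block. Let $\pi^*$ be the self-inverting permutation encoding $w$ and $F[\pi^*]$ the reducible permutation graph encoding $\pi^*$ (as defined in the context). Then: 1. If $B$ contains at least two 0s, then $\mathrm{minVM}(w)=3$. 2. If $B$ contains exactly one 0, i.e. $w=1\,1^{\ell}\,0\,1^{r}\,b_n$ with $\ell,r\ge 0$ (where $1^{m}$ denotes $m$ consecutive 1s), then $$\mathrm{minVM}(w)=\begin{cases}4+\min\{\ell,\,r-1\}, & \text{if } b_n=0 \text{ and } r>0,\\ 4, & \text{if } b_n=0 \text{ and } r=0,\\ 4+\min\{\ell,\,r\}, & \text{if } b_n=1 \text{ and } r\ge 0.\end{cases}$$ 3. If $B$ contains no 0s (i.e. $w=1\,1\cdots1\,b_n$), then $\mathrm{minVM}(w)=4$.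
   Context: Encoding of an integer as a self-inverting permutation (W-RPG codec). A permutation $\pi$ of $\{1,\dots,N\}$ is self-inverting (SiP) if $\pi_{\pi_i}=i$ for all $i$. Given $w\in R_n$ with $n$-bit binary representation $b=b_1\cdots b_n$, set $n^*=2n+1$ and form the binary string $B'=0^n\,\|\,b\,\|\,0$ of length $2n+1$ ($n$ zeros, then $b$, then one zero). Let $X$ be the increasing sequence of positions (in $\{1,\dots,2n+1\}$) of the 0s of $B'$ and $Y$ the increasing sequence of positions of the 1s of $B'$, and let $\pi^b=X\,\|\,Y^R$ (concatenation of $X$ with the reverse of $Y$), a sequence of length $2n+1$. The SiP $\pi^*=\pi^*(w)$ of $\{1,\dots,2n+1\}$ is the permutation whose cycles are the 2-cycles $(\pi^b_i,\pi^b_{2n+2-i})$ for $i=1,\dots,n$ and the 1-cycle $(\pi^b_{n+1})$. (E.g. $w=2^n-1$ gives $\pi^*=(n+1,\dots,2n,1,\dots,n,2n+1)$.) Reducible permutation graph. For a permutation $\pi$ of $\{1,\dots,2n+1\}$ and an element $i$, let $P_\pi(i)$ be the element of $\pi$ that lies to the left of $i$ in $\pi$, is greater than $i$, and is nearest to $i$ (equivalently, the maximum element of $\pi$ that directly dominates $i$); if no element to the left of $i$ is greater than $i$, set $P_\pi(i)=s$. The flow-graph $F[\pi]$ has nodes $t=0,1,\dots,2n+1,s=2n+2$, forward edges $i\to i-1$ for $1\le i\le 2n+2$, and back-edges $i\to P_\pi(i)$ for $1\le i\le 2n+1$. Valid edge-modifications. A modification of the edges of $F[\pi^*(w)]$ is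 valid if the result is again a graph $F[\pi^*(w')]$ produced by the codec for some $w'\in R_n$ (same $n$); for $w'\ne w$ such a graph is called true-incorrect. The number of edge-modifications needed to turn $F[\pi^*(w)]$ into $F[\pi^*(w')]$ is $d(w,w')=|\{i\in\{1,\dots,2n+1\}: P_{\pi^*(w)}(i)\ne P_{\pi^*(w')}(i)\}|$ (the number of back-edges whose target changes). Define $\mathrm{minVM}(w)=\min\{d(w,w') : w'\in R_n,\ w'\ne w\}$, the minimum number of valid edge-modifications of $F[\pi^*(w)]$.
   Formalization: Part 3 is proved only for n ≥ 4; as stated it is false for n = 2 and n = 3, where the numbers whose block B contains no 0s have minVM(2) = minVM(3) = 2 and minVM(6) = minVM(7) = 3. *)

theory Defs
  imports Complex_Main "HOL-Combinatorics.Transposition"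
begin

definition codec_range :: "nat \<Rightarrow> nat set" where
  "codec_range n = {2 ^ (n - 1) .. 2 ^ n - 1}"

text \<open>Binary digits are booleans (\<^const>\<open>True\<close> is the digit 1), most significant digit first,
  so the digit \<open>b\<^sub>i\<close> of an \<open>n\<close>-bit number is the list entry with index \<open>i - 1\<close>.\<close>

definition bin_rep :: "nat \<Rightarrow> nat \<Rightarrow> bool list" where
  "bin_rep n w = rev (map (bit w) [0..<n])"

definition internal_block :: "nat \<Rightarrow> nat \<Rightarrow> bool list" where
  "internal_block n w = butlast (tl (bin_rep n w))"

definition padded :: "nat \<Rightarrow> nat \<Rightarrow> bool list" where
  "padded n w = replicate n False @ bin_rep n w @ [False]"

definition zero_positions :: "bool list \<Rightarrow> nat list" where
  "zero_positions xs = filter (\<lambda>i. \<not> xs ! (i - 1)) [1..<length xs + 1]"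

definition one_positions :: "bool list \<Rightarrow> nat list" where
  "one_positions xs = filter (\<lambda>i. xs ! (i - 1)) [1..<length xs + 1]"

definition bitonic :: "nat \<Rightarrow> nat \<Rightarrow> nat list" where
  "bitonic n w = zero_positions (padded n w) @ rev (one_positions (padded n w))"

text \<open>The permutation with 2-cycles \<open>(\<pi>\<^sup>b\<^sub>i, \<pi>\<^sup>b\<^bsub>2n+2-i\<^esub>)\<close> for \<open>1 \<le> i \<le> n\<close>, as a product of transpositions.
  The transpositions are disjoint, so the order of composition is irrelevant, and the only
  element of \<open>{1..2n+1}\<close> that is not moved is \<open>\<pi>\<^sup>b\<^bsub>n+1\<^esub>\<close>.\<close>

definition sip_fun :: "nat \<Rightarrow> nat \<Rightarrow> nat \<Rightarrow> nat" where
  "sip_fun n w =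
     foldr (\<lambda>i p. transpose (bitonic n w ! (i - 1)) (bitonic n w ! (2 * n + 2 - i - 1)) \<circ> p)
       [1..<n + 1] id"

text \<open>One-line notation \<open>(\<pi>\<^sub>1, \<dots>, \<pi>\<^bsub>2n+1\<^esub>)\<close> of that permutation.\<close>

definition sip :: "nat \<Rightarrow> nat \<Rightarrow> nat list" where
  "sip n w = map (sip_fun n w) [1..<2 * n + 2]"

text \<open>For a permutation \<open>p\<close> of \<open>{1..N}\<close> in one-line notation, the nearest larger element to the
  left of \<open>i\<close>, or the source \<open>s = N + 1\<close> if there is none.\<close>

definition dom_target :: "nat list \<Rightarrow> nat \<Rightarrow> nat" where
  "dom_target p i =
     (let ds = filter (\<lambda>u. i < u) (takeWhile (\<lambda>u. u \<noteq> i) p)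
      in if ds = [] then length p + 1 else last ds)"

text \<open>The edges of the flow-graph \<open>F[p]\<close> on the nodes \<open>{0..N + 1}\<close>, where \<open>N = length p\<close>.\<close>

definition forward_edges :: "nat list \<Rightarrow> (nat \<times> nat) set" where
  "forward_edges p = {(i, i - 1) | i. i \<in> {1..length p + 1}}"

definition back_edges :: "nat list \<Rightarrow> (nat \<times> nat) set" where
  "back_edges p = {(i, dom_target p i) | i. i \<in> {1..length p}}"

definition flow_edges :: "nat list \<Rightarrow> (nat \<times> nat) set" where
  "flow_edges p = forward_edges p \<union> back_edges p"

definition edge_mods :: "nat \<Rightarrow> nat \<Rightarrow> nat \<Rightarrow> nat" where
  "edge_mods n w w' =
     card {i \<in> {1..2 * n + 1}. dom_target (sip n w) i \<noteq> dom_target (sip n w') i}"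

definition minVM :: "nat \<Rightarrow> nat \<Rightarrow> nat" where
  "minVM n w = Min (edge_mods n w ` (codec_range n - {w}))"

lemma dom_target_greater:
  assumes "i \<le> length p"
  shows "i < dom_target p i"
proof -
  let ?ds = "filter (\<lambda>u. i < u) (takeWhile (\<lambda>u. u \<noteq> i) p)"
  have "?ds \<noteq> [] \<Longrightarrow> last ?ds \<in> set ?ds" by (rule last_in_set)
  then have "?ds \<noteq> [] \<Longrightarrow> i < last ?ds" by simp
  then show ?thesis using assms by (simp add: dom_target_def Let_def)
qed

text \<open>\<^const>\<open>edge_mods\<close> counts the edges of one flow-graph that are missing in the other.\<close>

lemma edge_mods_eq_card_flow_edges_diff:
  "edge_mods n w w' = card (flow_edges (sip n w) - flow_edges (sip n w'))"
proof -
  let ?p = "sip n w" and ?q = "sip n w'"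
  have len: "length ?p = 2 * n + 1" "length ?q = 2 * n + 1" by (simp_all add: sip_def)
  have gp: "i < dom_target ?p i" if "i \<le> 2 * n + 1" for i
    using dom_target_greater[of i ?p] that len by simp
  have "flow_edges ?p - flow_edges ?q =
      (\<lambda>i. (i, dom_target ?p i)) ` {i \<in> {1..2 * n + 1}. dom_target ?p i \<noteq> dom_target ?q i}"
    (is "?L = ?R")
  proof
    show "?L \<subseteq> ?R"
      unfolding flow_edges_def forward_edges_def back_edges_def len by auto
    show "?R \<subseteq> ?L"
    proof
      fix e assume "e \<in> ?R"
      then obtain i where i: "e = (i, dom_target ?p i)" "i \<in> {1..2 * n + 1}"
        "dom_target ?p i \<noteq> dom_target ?q i" by blast
      moreover have "dom_target ?p i \<noteq> i - 1" using gp[of i] i(2) by simp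
      ultimately show "e \<in> ?L"
        unfolding flow_edges_def forward_edges_def back_edges_def len by auto
    qed
  qed
  then show ?thesis
    by (simp add: edge_mods_def card_image inj_on_def)
qed

lemma "sip 3 7 = [4, 5, 6, 1, 2, 3, 7]" by code_simp

text \<open>All numbers without internal 0s for \<open>n \<in> {2, 3}\<close>. The value 4 that such numbers have for
  \<open>n \<ge> 4\<close> is not attained here.\<close>

lemma minVM_small:
  "minVM 2 2 = 2" "minVM 2 3 = 2" "minVM 3 6 = 3" "minVM 3 7 = 3"
  by code_simp+

end

theory Submission
  imports Defs
begin

text \<open>Write positions \<open>v > n\<close> as zeros or ones according to the padded word. The permutation
  exchanges the \<open>k\<close>-th one (counted from 1) with \<open>k\<close> and the \<open>k\<close>-th zero (counted from 0) with
  \<open>n + 1 - k\<close>, except that the first zero is fixed. Hence a one points to the source, a zero points to the next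
  zero, and an element \<open>i \<le> n\<close>, sitting at position \<open>y > n\<close>, points to the partner of the
  largest zero below \<open>y\<close>, or to the second zero (\<open>2 * n\<close> if there is none) when \<open>y\<close> precedes all
  zeros. So all digits before the first zero share a target, and the targets of \<open>n\<close> and
  \<open>1\<close> reveal the first two zeros.

  If there are two internal zeros, flipping the last digit changes three targets. With a single
  internal zero one must either move it, which changes the targets of all later indices, or
  change the second zero, which changes the targets of all earlier indices. This is where the
  minimum over \<open>l\<close> and \<open>r\<close> comes from. The lower bounds compare the first two zeros of the
  two numbers.\<close>

section \<open>The self-inverting permutation\<close>

text \<open>A flipped digit always costs the edge at its own position, since a zero points to at
  most \<open>2 * n + 1\<close> and a one to \<open>2 * n + 2\<close>. The real work is to count the
  changed targets among the elements up to \<open>n\<close>. Position \<open>2 * n + 1\<close> is a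
  permanent zero, so a second zero exists even if the digits contain only one 0. Two coincidences
  shape the formula. The element \<open>n - 1\<close> points to \<open>n\<close> as soon as two
  digits are 0, wherever they are, so moving the internal zero saves one edge if the last digit
  stays 0: this turns \<open>r\<close> into \<open>r - 1\<close>. For \<open>r = 0\<close> that move
  would collide with the last digit, and the value is 4. Moreover, the word without a digit 0 sends
  every small element to \<open>2 * n\<close>, and so does the word with zeros at
  \<open>2 * n - 1\<close> and \<open>2 * n\<close> for the elements up to \<open>n - 2\<close>;
  hence these words differ in at most four edges. Flipping only the last digit of the all-one word
  costs \<open>n\<close> edges, which is why the last claim asks for
  \<open>n \<ge> 4\<close>.\<close>

lemma foldr_transpose_nth:
  assumes "distinct xs" "length xs = 2 * n + 1" "distinct is" "set is \<subseteq> {1..n}" "k < 2 * n + 1"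
  shows "foldr (\<lambda>i p. transpose (xs ! (i - 1)) (xs ! (2 * n + 2 - i - 1)) \<circ> p) is id (xs ! k) =
    (if k + 1 \<in> set is \<or> 2 * n + 1 - k \<in> set is then xs ! (2 * n - k) else xs ! k)"
  using assms(3,4)
proof (induction "is")
  case Nil
  then show ?case by simp
next
  case (Cons a js)
  have a: "1 \<le> a" "a \<le> n" "a \<notin> set js" "set js \<subseteq> {1..n}" using Cons.prems by auto
  have eq: "xs ! j = xs ! j' \<longleftrightarrow> j = j'" if "j < 2 * n + 1" "j' < 2 * n + 1" for j j'
    using that assms(1,2) by (simp add: nth_eq_iff_index_eq)
  have IH: "foldr (\<lambda>i p. transpose (xs ! (i - 1)) (xs ! (2 * n + 2 - i - 1)) \<circ> p) js id (xs ! k) =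
    (if k + 1 \<in> set js \<or> 2 * n + 1 - k \<in> set js then xs ! (2 * n - k) else xs ! k)"
    using Cons.prems by (intro Cons.IH) auto
  have step: "foldr (\<lambda>i p. transpose (xs ! (i - 1)) (xs ! (2 * n + 2 - i - 1)) \<circ> p) (a # js) id (xs ! k) =
      transpose (xs ! (a - 1)) (xs ! (2 * n + 2 - a - 1))
        (foldr (\<lambda>i p. transpose (xs ! (i - 1)) (xs ! (2 * n + 2 - i - 1)) \<circ> p) js id (xs ! k))"
    by simp
  \<comment> \<open>The pair exchanged for \<open>a\<close> has list indices \<open>a - 1\<close>
    and \<open>2 * n + 1 - a\<close>, and the first two cases say that \<open>k\<close> is one of
    them. Since \<open>js\<close> holds numbers up to \<open>n\<close> other than \<open>a\<close>,
    its transpositions leave that entry in place.\<close>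
  consider "k + 1 = a" | "2 * n + 1 - k = a" | "k + 1 \<noteq> a" "2 * n + 1 - k \<noteq> a" by blast
  then show ?case
  proof cases
    case 1
    have "2 * n + 1 - k > n" using 1 a by linarith
    then have "2 * n + 1 - k \<notin> set js" using a by auto
    then have "foldr (\<lambda>i p. transpose (xs ! (i - 1)) (xs ! (2 * n + 2 - i - 1)) \<circ> p) js id (xs ! k) = xs ! (a - 1)"
      using IH 1 a by auto
    moreover have "2 * n + 2 - a - 1 = 2 * n - k" using 1 by auto
    ultimately show ?thesis unfolding step using 1 by simp
  next
    case 2
    have "k + 1 > n" using 2 a by linarith
    then have "k + 1 \<notin> set js" using a by auto
    then have "foldr (\<lambda>i p. transpose (xs ! (i - 1)) (xs ! (2 * n + 2 - i - 1)) \<circ> p) js id (xs ! k)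
        = xs ! (2 * n + 2 - a - 1)"
      using IH 2 a assms(5) by auto
    moreover have "a - 1 = 2 * n - k" using 2 by auto
    ultimately show ?thesis unfolding step using 2 by simp
  next
    case 3
    \<comment> \<open>The index of the value after the transpositions of \<open>js\<close>: either
      \<open>k\<close> or its mirror image. Neither belongs to the pair of \<open>a\<close>.\<close>
    let ?k = "if k + 1 \<in> set js \<or> 2 * n + 1 - k \<in> set js then 2 * n - k else k"
    have "?k \<noteq> a - 1" "?k \<noteq> 2 * n + 2 - a - 1" "?k < 2 * n + 1"
      using 3 a assms(5) by auto
    then have "xs ! ?k \<noteq> xs ! (a - 1)" "xs ! ?k \<noteq> xs ! (2 * n + 2 - a - 1)"
      using eq a by auto
    then show ?thesis unfolding step IH using 3 a by (auto simp: transpose_apply_other)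
  qed
qed

text \<open>The entries before \<open>v\<close> in the filtered interval are exactly the smaller
  elements that pass the filter. This turns the ranks \<open>ones_below\<close> and
  \<open>zeros_below\<close> into list indices of \<open>bitonic\<close>.\<close>

lemma nth_filter_upt:
  assumes "Q v" "a \<le> v" "v < b"
  shows "card {u \<in> {a..<v}. Q u} < length (filter Q [a..<b])"
    and "filter Q [a..<b] ! card {u \<in> {a..<v}. Q u} = v"
proof -
  have "[a..<b] = [a..<v] @ v # [Suc v..<b]"
    using assms by (metis le_eq_less_or_eq upt_add_eq_append upt_conv_Cons le_Suc_ex)
  moreover have "card {u \<in> {a..<v}. Q u} = length (filter Q [a..<v])"
    using distinct_card[of "filter Q [a..<v]"] by simp
  ultimately show "card {u \<in> {a..<v}. Q u} < length (filter Q [a..<b])"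
    and "filter Q [a..<b] ! card {u \<in> {a..<v}. Q u} = v"
    using assms(1) by simp_all
qed

section \<open>Ones and zeros among the positions above n, and their ranks\<close>

definition one_at :: "nat \<Rightarrow> nat \<Rightarrow> nat \<Rightarrow> bool" where
  "one_at n w v \<longleftrightarrow> n < v \<and> v \<le> 2 * n \<and> bit w (2 * n - v)"

text \<open>The padding digit at \<open>2 * n + 1\<close> counts as a zero, but the \<open>n\<close>
  leading padding zeros do not: those positions are the small elements with which the others are
  exchanged.\<close>

definition zero_at :: "nat \<Rightarrow> nat \<Rightarrow> nat \<Rightarrow> bool" where
  "zero_at n w v \<longleftrightarrow> n < v \<and> v \<le> 2 * n + 1 \<and> \<not> one_at n w v"

definition ones_below :: "nat \<Rightarrow> nat \<Rightarrow> nat \<Rightarrow> nat" where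
  "ones_below n w v = card {u. u < v \<and> one_at n w u}"

definition zeros_below :: "nat \<Rightarrow> nat \<Rightarrow> nat \<Rightarrow> nat" where
  "zeros_below n w v = card {u. u < v \<and> zero_at n w u}"

lemma zero_at_last [simp]: "zero_at n w (2 * n + 1)" "zero_at n w (Suc (2 * n))"
  by (simp_all add: zero_at_def one_at_def)

lemma zero_at_bounds: "zero_at n w v \<Longrightarrow> n < v \<and> v \<le> 2 * n + 1"
  by (simp add: zero_at_def)

lemma one_at_bounds: "one_at n w v \<Longrightarrow> n < v \<and> v \<le> 2 * n"
  by (simp add: one_at_def)

lemma one_at_not_zero_at: "one_at n w v \<Longrightarrow> \<not> zero_at n w v"
  by (simp add: zero_at_def)

lemma one_at_or_zero_at: "n < v \<Longrightarrow> v \<le> 2 * n + 1 \<Longrightarrow> one_at n w v \<or> zero_at n w v"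
  by (simp add: zero_at_def)

lemma below_add:
  assumes "n < v" "v \<le> 2 * n + 2"
  shows "ones_below n w v + zeros_below n w v = v - Suc n"
proof -
  have "{u. u < v \<and> one_at n w u} \<union> {u. u < v \<and> zero_at n w u} = {Suc n..<v}"
    using assms by (auto simp: zero_at_def one_at_def)
  moreover have "{u. u < v \<and> one_at n w u} \<inter> {u. u < v \<and> zero_at n w u} = {}"
    by (auto simp: zero_at_def)
  ultimately have "card {Suc n..<v} = ones_below n w v + zeros_below n w v"
    unfolding ones_below_def zeros_below_def by (metis card_Un_disjoint finite_Collect_conjI finite_Collect_less_nat)
  then show ?thesis by simp
qed

lemma zeros_below_mono: "u \<le> v \<Longrightarrow> zeros_below n w u \<le> zeros_below n w v"
  unfolding zeros_below_def by (intro card_mono) auto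

lemma ones_below_less: "one_at n w u \<Longrightarrow> u < v \<Longrightarrow> ones_below n w u < ones_below n w v"
  unfolding ones_below_def by (intro psubset_card_mono) auto

lemma zeros_below_less: "zero_at n w u \<Longrightarrow> u < v \<Longrightarrow> zeros_below n w u < zeros_below n w v"
  unfolding zeros_below_def by (intro psubset_card_mono) auto

lemma zeros_below_next:
  assumes "zero_at n w u" "u < v" "\<And>x. u < x \<Longrightarrow> x < v \<Longrightarrow> \<not> zero_at n w x"
  shows "zeros_below n w v = Suc (zeros_below n w u)"
proof -
  have "{x. x < v \<and> zero_at n w x} = insert u {x. x < u \<and> zero_at n w x}"
    using assms by (auto simp: not_less) (metis linorder_neqE_nat)
  then show ?thesis by (simp add: zeros_below_def)
qed

lemma zeros_below_eq_0: "(\<And>x. x < v \<Longrightarrow> \<not> zero_at n w x) \<Longrightarrow> zeros_below n w v = 0"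
  by (auto simp: zeros_below_def)

lemma zeros_below_0D: "zeros_below n w v = 0 \<Longrightarrow> x < v \<Longrightarrow> \<not> zero_at n w x"
  by (auto simp: zeros_below_def)

section \<open>The bitonic sequence indexed by ranks\<close>

lemma padded_nth:
  assumes "1 \<le> v" "v \<le> 2 * n + 1"
  shows "padded n w ! (v - 1) \<longleftrightarrow> one_at n w v"
proof -
  have "rev (map (bit w) [0..<n]) ! (v - 1 - n) = bit w (2 * n - v)" if "n < v" "v \<le> 2 * n"
    using that by (simp add: rev_nth mult_2)
  moreover have "v - 1 - n < n" if "n < v" "v \<le> 2 * n" using that by linarith
  moreover have "v - 1 - n = n" if "\<not> v \<le> 2 * n" using that assms by linarith
  ultimately show ?thesis using assms
    by (cases "v \<le> n"; cases "v \<le> 2 * n") (auto simp: padded_def bin_rep_def one_at_def nth_append)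
qed

lemma length_padded [simp]: "length (padded n w) = 2 * n + 1"
  by (simp add: padded_def bin_rep_def)

lemma zero_positions_padded:
  "zero_positions (padded n w) = filter (\<lambda>v. \<not> one_at n w v) [1..<2 * n + 2]"
  unfolding zero_positions_def by (intro filter_cong) (auto simp del: One_nat_def upt_Suc simp: padded_nth)

lemma one_positions_padded:
  "one_positions (padded n w) = filter (one_at n w) [1..<2 * n + 2]"
  unfolding one_positions_def by (intro filter_cong) (auto simp del: One_nat_def upt_Suc simp: padded_nth)

lemma set_bitonic: "set (bitonic n w) = {1..2 * n + 1}"
  by (auto simp: bitonic_def zero_positions_padded one_positions_padded)

lemma distinct_bitonic: "distinct (bitonic n w)"
  by (auto simp: bitonic_def zero_positions_padded one_positions_padded)

lemma length_bitonic: "length (bitonic n w) = 2 * n + 1"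
  using distinct_card[OF distinct_bitonic, of n w] by (simp add: set_bitonic)

text \<open>The ones close the sequence in reverse order, so the one of rank 0 has the last index
  \<open>2 * n\<close>.\<close>

lemma bitonic_nth_one:
  assumes "one_at n w v"
  shows "bitonic n w ! (2 * n - ones_below n w v) = v"
proof -
  let ?Z = "zero_positions (padded n w)" and ?O = "one_positions (padded n w)"
  have "{u \<in> {1..<v}. one_at n w u} = {u. u < v \<and> one_at n w u}" by (auto simp: one_at_def)
  then have *: "ones_below n w v < length ?O" "?O ! ones_below n w v = v"
    using nth_filter_upt[of "one_at n w" v 1 "2 * n + 2"] assms one_at_bounds[OF assms]
    by (simp_all add: ones_below_def one_positions_padded)
  have l: "length ?Z + length ?O = 2 * n + 1"
    using length_bitonic[of n w] by (simp add: bitonic_def)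
  have "bitonic n w ! (2 * n - ones_below n w v) = rev ?O ! (2 * n - ones_below n w v - length ?Z)"
  proof -
    have "\<not> 2 * n - ones_below n w v < length ?Z" using l * by linarith
    then show ?thesis by (simp add: bitonic_def nth_append)
  qed
  also have "\<dots> = ?O ! ones_below n w v"
  proof -
    have "2 * n - ones_below n w v - length ?Z < length ?O"
      "length ?O - Suc (2 * n - ones_below n w v - length ?Z) = ones_below n w v"
      using l * by linarith+
    then show ?thesis by (simp add: rev_nth)
  qed
  finally show ?thesis using * by simp
qed

lemma bitonic_nth_not_one:
  assumes "\<not> one_at n w v" "1 \<le> v" "v \<le> 2 * n + 1"
  shows "bitonic n w ! card {u \<in> {1..<v}. \<not> one_at n w u} = v"
  using nth_filter_upt[of "\<lambda>v. \<not> one_at n w v" v 1 "2 * n + 2"] assms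
  by (simp add: bitonic_def zero_positions_padded nth_append del: upt_Suc)

lemma bitonic_nth_low: "1 \<le> i \<Longrightarrow> i \<le> n \<Longrightarrow> bitonic n w ! (i - 1) = i"
proof -
  assume i: "1 \<le> i" "i \<le> n"
  then have "{u \<in> {1..<i}. \<not> one_at n w u} = {1..<i}" by (auto simp: one_at_def)
  with i show ?thesis using bitonic_nth_not_one[of n w i] by (simp add: one_at_def)
qed

text \<open>The \<open>n\<close> padding positions come before all these zeros, whence the offset
  \<open>n\<close>. The first zero therefore has the middle index.\<close>

lemma bitonic_nth_zero: 
  assumes "zero_at n w v"
  shows "bitonic n w ! (n + zeros_below n w v) = v"
proof -
  have "{u \<in> {1..<v}. \<not> one_at n w u} = {1..n} \<union> {u. u < v \<and> zero_at n w u}"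
    using assms by (auto simp: zero_at_def one_at_def)
  moreover have "card ({1..n} \<union> {u. u < v \<and> zero_at n w u}) = n + zeros_below n w v"
    unfolding zeros_below_def by (subst card_Un_disjoint) (auto simp: zero_at_def)
  ultimately show ?thesis using bitonic_nth_not_one[of n w v] assms by (simp add: zero_at_def)
qed

section \<open>The involution on ones, zeros and small elements\<close>

lemma sip_fun_nth: "k \<le> 2 * n \<Longrightarrow> sip_fun n w (bitonic n w ! k) = bitonic n w ! (2 * n - k)"
proof -
  assume k: "k \<le> 2 * n"
  have "sip_fun n w (bitonic n w ! k) = 
    (if k + 1 \<in> set [1..<n+1] \<or> 2 * n + 1 - k \<in> set [1..<n+1] then bitonic n w ! (2 * n - k) else bitonic n w ! k)"
    unfolding sip_fun_def using k
    by (intro foldr_transpose_nth distinct_bitonic length_bitonic) auto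
  \<comment> \<open>Only the middle index \<open>k = n\<close> escapes both conditions, and
    reflection fixes it.\<close>
  moreover have "k = 2 * n - k" if "\<not> (k + 1 \<in> set [1..<n+1] \<or> 2 * n + 1 - k \<in> set [1..<n+1])"
    using that k by auto
  ultimately show ?thesis by auto
qed

lemma sip_fun_one:
  assumes "one_at n w v"
  shows "sip_fun n w v = Suc (ones_below n w v)" "ones_below n w v < n"
proof -
  have "ones_below n w v + zeros_below n w v = v - Suc n"
    using below_add[of n v w] one_at_bounds[OF assms] by simp
  then show *: "ones_below n w v < n" using one_at_bounds[OF assms] by linarith
  then show "sip_fun n w v = Suc (ones_below n w v)"
    using sip_fun_nth[of "2 * n - ones_below n w v" n w] bitonic_nth_one[OF assms]
      bitonic_nth_low[of "Suc (ones_below n w v)" n w] by simp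
qed

lemma sip_fun_zero:
  assumes "zero_at n w v"
  shows "sip_fun n w v = (if zeros_below n w v = 0 then v else Suc n - zeros_below n w v)"
    "zeros_below n w v \<le> n"
proof -
  have "ones_below n w v + zeros_below n w v = v - Suc n"
    using below_add[of n v w] zero_at_bounds[OF assms] by simp
  then show *: "zeros_below n w v \<le> n" using zero_at_bounds[OF assms] by linarith
  then have "sip_fun n w v = bitonic n w ! (n - zeros_below n w v)"
    using sip_fun_nth[of "n + zeros_below n w v" n w] bitonic_nth_zero[OF assms] by simp
  then show "sip_fun n w v = (if zeros_below n w v = 0 then v else Suc n - zeros_below n w v)"
    using bitonic_nth_low[of "Suc (n - zeros_below n w v)" n w] bitonic_nth_zero[OF assms] *
    by (auto simp: Suc_diff_le)
qed

lemma bitonic_index: 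
  assumes "1 \<le> v" "v \<le> 2 * n + 1"
  obtains k where "k \<le> 2 * n" "v = bitonic n w ! k"
proof -
  have "v \<in> set (bitonic n w)" using assms by (simp add: set_bitonic)
  then show ?thesis using that by (auto simp: in_set_conv_nth length_bitonic less_Suc_eq_le)
qed

lemma sip_fun_range: "1 \<le> v \<Longrightarrow> v \<le> 2 * n + 1 \<Longrightarrow> 1 \<le> sip_fun n w v \<and> sip_fun n w v \<le> 2 * n + 1"
proof -
  assume "1 \<le> v" "v \<le> 2 * n + 1"
  then obtain k where k: "k \<le> 2 * n" "v = bitonic n w ! k" by (rule bitonic_index)
  then have "sip_fun n w v \<in> set (bitonic n w)"
    by (simp add: sip_fun_nth length_bitonic less_Suc_eq_le)
  then show ?thesis by (simp add: set_bitonic)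
qed

lemma sip_fun_invol: "1 \<le> v \<Longrightarrow> v \<le> 2 * n + 1 \<Longrightarrow> sip_fun n w (sip_fun n w v) = v"
proof -
  assume "1 \<le> v" "v \<le> 2 * n + 1"
  then obtain k where k: "k \<le> 2 * n" "v = bitonic n w ! k" by (rule bitonic_index)
  then show ?thesis by (simp add: sip_fun_nth)
qed

text \<open>A small element occupies one of the first \<open>n\<close> list indices, its partner one
  of the last \<open>n\<close>. A small partner would occupy two indices at once.\<close>

lemma sip_fun_low:
  assumes "1 \<le> i" "i \<le> n"
  shows "n < sip_fun n w i" "sip_fun n w i \<le> 2 * n + 1"
proof -
  show "sip_fun n w i \<le> 2 * n + 1" using sip_fun_range[of i n w] assms by simp
  show "n < sip_fun n w i"
  proof (rule ccontr)
    assume "\<not> ?thesis"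
    then have j: "1 \<le> sip_fun n w i" "sip_fun n w i \<le> n" using sip_fun_range[of i n w] assms by auto
    have "sip_fun n w i = bitonic n w ! (2 * n - (i - 1))"
      using sip_fun_nth[of "i - 1" n w] bitonic_nth_low[of i n w] assms by simp
    then have "bitonic n w ! (sip_fun n w i - 1) = bitonic n w ! (2 * n - (i - 1))"
      using bitonic_nth_low[OF j, of w] by simp
    then have "sip_fun n w i - 1 = 2 * n - (i - 1)"
      using distinct_bitonic[of n w] j assms by (simp add: nth_eq_iff_index_eq length_bitonic)
    then show False using j assms by linarith
  qed
qed

text \<open>A self-inverting permutation holds the element \<open>i\<close> at position \<open>sip_fun n w i\<close>.\<close>

lemma takeWhile_sip:
  assumes "1 \<le> i" "i \<le> 2 * n + 1"
  shows "takeWhile (\<lambda>u. u \<noteq> i) (sip n w) = map (sip_fun n w) [1..<sip_fun n w i]"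
proof -
  let ?p = "sip_fun n w"
  have r: "1 \<le> ?p i" "?p i \<le> 2 * n + 1" using sip_fun_range[OF assms] by auto
  have "[1..<2 * n + 2] = [1..<?p i] @ ?p i # [Suc (?p i)..<2 * n + 2]"
    using r by (metis Suc_1 Suc_eq_plus1 add_Suc_right le_imp_less_Suc less_imp_le_nat upt_add_eq_append upt_conv_Cons le_Suc_ex)
  then have eq: "sip n w = map ?p [1..<?p i] @ i # map ?p [Suc (?p i)..<2 * n + 2]"
    using sip_fun_invol[OF assms] by (simp add: sip_def)
  have "u \<noteq> i" if "u \<in> set (map ?p [1..<?p i])" for u
  proof -
    obtain x where x: "u = ?p x" "1 \<le> x" "x < ?p i" using \<open>u \<in> _\<close> by auto
    then have "?p u = x" using r by (simp add: sip_fun_invol)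
    then show ?thesis using x by auto
  qed
  then have "takeWhile (\<lambda>u. u \<noteq> i) (map ?p [1..<?p i] @ i # map ?p [Suc (?p i)..<2 * n + 2]) =
      map ?p [1..<?p i] @ takeWhile (\<lambda>u. u \<noteq> i) (i # map ?p [Suc (?p i)..<2 * n + 2])"
    by (rule takeWhile_append2)
  then show ?thesis unfolding eq by (simp del: upt_Suc)
qed

section \<open>Reading a target off the one-line notation\<close>

abbreviation target :: "nat \<Rightarrow> nat \<Rightarrow> nat \<Rightarrow> nat" where
  "target n w \<equiv> dom_target (sip n w)"

lemma target_none:
  assumes "1 \<le> i" "i \<le> 2 * n + 1"
    and "\<And>u. 1 \<le> u \<Longrightarrow> u < sip_fun n w i \<Longrightarrow> sip_fun n w u \<le> i"
  shows "target n w i = 2 * n + 2"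
proof -
  have "filter (\<lambda>u. i < u) (takeWhile (\<lambda>u. u \<noteq> i) (sip n w)) = []"
    unfolding takeWhile_sip[OF assms(1,2)] using assms(3) by (auto simp: filter_empty_conv not_less)
  then show ?thesis by (simp add: dom_target_def sip_def)
qed

lemma target_eq:
  assumes "1 \<le> i" "i \<le> 2 * n + 1" "1 \<le> v" "v < sip_fun n w i" "i < sip_fun n w v"
    and "\<And>u. v < u \<Longrightarrow> u < sip_fun n w i \<Longrightarrow> sip_fun n w u \<le> i"
  shows "target n w i = sip_fun n w v"
proof -
  let ?p = "sip_fun n w"
  have "[1..<?p i] = [1..<v] @ v # [Suc v..<?p i]"
    using assms(3,4) by (metis less_imp_le_nat upt_add_eq_append upt_conv_Cons le_Suc_ex)
  moreover have "filter (\<lambda>u. i < u) (map ?p [Suc v..<?p i]) = []"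
    using assms(6) by (auto simp: filter_empty_conv not_less)
  ultimately have "filter (\<lambda>u. i < u) (takeWhile (\<lambda>u. u \<noteq> i) (sip n w)) =
      filter (\<lambda>u. i < u) (map ?p [1..<v]) @ [?p v]"
    unfolding takeWhile_sip[OF assms(1,2)] using assms(5) by (simp del: upt_Suc)
  then show ?thesis by (simp add: dom_target_def)
qed

section \<open>The back-edge targets\<close>

lemma sip_fun_cases:
  assumes "1 \<le> i" "i \<le> n"
  obtains (one_at) "one_at n w (sip_fun n w i)" "i = Suc (ones_below n w (sip_fun n w i))"
  | (zero_at) "zero_at n w (sip_fun n w i)" "1 \<le> zeros_below n w (sip_fun n w i)"
      "zeros_below n w (sip_fun n w i) \<le> n" "i = Suc n - zeros_below n w (sip_fun n w i)"
proof -
  let ?y = "sip_fun n w i"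
  have y: "n < ?y" "?y \<le> 2 * n + 1" "sip_fun n w ?y = i"
    using sip_fun_low[OF assms] sip_fun_invol[of i n w] assms by auto
  show ?thesis
  proof (cases "one_at n w ?y")
    case True
    then show ?thesis using one_at sip_fun_one(1)[OF True] y by simp
  next
    case False
    then have z: "zero_at n w ?y" using y by (simp add: zero_at_def)
    \<comment> \<open>The first zero is fixed and exceeds \<open>n\<close>, so it is not the partner
      of \<open>i\<close>.\<close>
    have nz: "zeros_below n w ?y \<noteq> 0" using sip_fun_zero(1)[OF z] y assms by (cases "zeros_below n w ?y = 0") auto
    show ?thesis
    proof (rule zero_at[OF z])
      show "1 \<le> zeros_below n w ?y" "zeros_below n w ?y \<le> n" using nz sip_fun_zero(2)[OF z] by auto
      show "i = Suc n - zeros_below n w ?y" using nz sip_fun_zero(1)[OF z] y by simp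
    qed
  qed
qed

text \<open>The positions strictly between \<open>v\<close> and that of \<open>i\<close> are ones of
  too small a rank to hold an element above \<open>i\<close>, while the rank of \<open>v\<close>
  makes its partner exceed \<open>i\<close>. So the search to the left stops at
  \<open>v\<close>.\<close>

lemma target_low_zero:
  assumes i: "1 \<le> i" "i \<le> n" and v: "zero_at n w v" "v < sip_fun n w i"
    and gap: "\<And>u. v < u \<Longrightarrow> u < sip_fun n w i \<Longrightarrow> \<not> zero_at n w u"
  shows "target n w i = sip_fun n w v"
proof (rule target_eq)
  let ?y = "sip_fun n w i"
  have y: "n < ?y" "?y \<le> 2 * n + 1" using sip_fun_low[OF i] by auto
  have vb: "n < v" "v \<le> 2 * n + 1" using zero_at_bounds[OF v(1)] by auto
  have z: "zeros_below n w ?y = Suc (zeros_below n w v)" using zeros_below_next[OF v gap] .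
  have s: "ones_below n w ?y + zeros_below n w ?y = ?y - Suc n" using below_add y by simp
  show "1 \<le> i" "i \<le> 2 * n + 1" "1 \<le> v" "v < ?y" using i v vb by auto
  from i show "i < sip_fun n w v"
  proof (cases rule: sip_fun_cases[where w = w])
    case one_at
    then show ?thesis using sip_fun_zero[OF v(1)] z s i vb one_at_bounds[OF one_at(1)] by auto
  next
    case zero_at
    then show ?thesis using sip_fun_zero[OF v(1)] z i vb by auto
  qed
  fix u assume u: "v < u" "u < ?y"
  then have ou: "one_at n w u" using gap[OF u] vb y one_at_or_zero_at[of n u w] by auto
  then have "sip_fun n w u = Suc (ones_below n w u)" "ones_below n w u < ones_below n w ?y"
    using sip_fun_one ones_below_less u by auto
  with i show "sip_fun n w u \<le> i"
    by (cases rule: sip_fun_cases[where w = w]) (use s y in auto)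
qed

text \<open>Only ones lie between position \<open>n\<close> and that of \<open>i\<close>, and they
  hold elements up to \<open>i\<close>. Position \<open>n\<close> holds an element above
  \<open>n\<close>, so the search stops there.\<close>

lemma target_low_none:
  assumes i: "1 \<le> i" "i \<le> n" and gap: "\<And>u. u < sip_fun n w i \<Longrightarrow> \<not> zero_at n w u"
  shows "target n w i = sip_fun n w n"
proof (rule target_eq)
  let ?y = "sip_fun n w i"
  have y: "n < ?y" "?y \<le> 2 * n + 1" using sip_fun_low[OF i] by auto
  show "1 \<le> i" "i \<le> 2 * n + 1" "1 \<le> n" "n < ?y" using i y by auto
  show "i < sip_fun n w n" using sip_fun_low(1)[of n n w] i by auto
  have z: "zeros_below n w ?y = 0" using gap by (rule zeros_below_eq_0)
  fix u assume u: "n < u" "u < ?y"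
  then have ou: "one_at n w u" using gap[OF u(2)] y one_at_or_zero_at[of n u w] by auto
  then have "sip_fun n w u = Suc (ones_below n w u)" "ones_below n w u < ones_below n w ?y"
    using sip_fun_one ones_below_less u by auto
  with i show "sip_fun n w u \<le> i"
    by (cases rule: sip_fun_cases[where w = w]) (use z in auto)
qed

section \<open>Successive zeros and the edges leaving ones and zeros\<close>

definition next_zero :: "nat \<Rightarrow> nat \<Rightarrow> nat \<Rightarrow> nat" where
  "next_zero n w v = (LEAST u. v < u \<and> zero_at n w u)"

definition first_zero :: "nat \<Rightarrow> nat \<Rightarrow> nat" where
  "first_zero n w = next_zero n w n"

lemma next_zero:
  assumes "v \<le> 2 * n"
  shows "zero_at n w (next_zero n w v)" "v < next_zero n w v" "next_zero n w v \<le> 2 * n + 1"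
    "n < next_zero n w v"
    "v < u \<Longrightarrow> u < next_zero n w v \<Longrightarrow> \<not> zero_at n w u"
    "v < u \<Longrightarrow> zero_at n w u \<Longrightarrow> next_zero n w v \<le> u"
proof -
  \<comment> \<open>The permanent zero makes the \<open>LEAST\<close> well defined.\<close>
  have *: "v < 2 * n + 1 \<and> zero_at n w (2 * n + 1)" using assms by simp
  have l: "v < next_zero n w v \<and> zero_at n w (next_zero n w v)"
    unfolding next_zero_def by (rule LeastI) (fact *)
  then show "zero_at n w (next_zero n w v)" "v < next_zero n w v" by auto
  show "next_zero n w v \<le> 2 * n + 1" "n < next_zero n w v" using l zero_at_bounds by auto
  show le: "v < u \<Longrightarrow> zero_at n w u \<Longrightarrow> next_zero n w v \<le> u" for u
    unfolding next_zero_def by (rule Least_le) simp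
  show "v < u \<Longrightarrow> u < next_zero n w v \<Longrightarrow> \<not> zero_at n w u" using le by fastforce
qed

lemma next_zero_eqI:
  assumes "zero_at n w u" "v < u" "\<And>x. v < x \<Longrightarrow> x < u \<Longrightarrow> \<not> zero_at n w x"
  shows "next_zero n w v = u"
  unfolding next_zero_def by (rule Least_equality) (use assms not_less in blast)+

lemma zeros_below_first: "zeros_below n w (first_zero n w) = 0"
proof (rule zeros_below_eq_0)
  fix x assume "x < first_zero n w"
  then show "\<not> zero_at n w x"
    using next_zero(5)[of n n x w] zero_at_bounds[of n w x] by (auto simp: first_zero_def)
qed

lemma first_zero:
  shows "zero_at n w (first_zero n w)" "n < first_zero n w" "first_zero n w \<le> 2 * n + 1"
    "u < first_zero n w \<Longrightarrow> \<not> zero_at n w u"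
    "zero_at n w u \<Longrightarrow> first_zero n w \<le> u"
    "n < u \<Longrightarrow> u < first_zero n w \<Longrightarrow> one_at n w u"
proof -
  show "zero_at n w (first_zero n w)" "n < first_zero n w" "first_zero n w \<le> 2 * n + 1"
    using next_zero[of n n w] by (auto simp: first_zero_def)
  show z: "u < first_zero n w \<Longrightarrow> \<not> zero_at n w u" for u
    using zeros_below_0D[OF zeros_below_first] .
  show "zero_at n w u \<Longrightarrow> first_zero n w \<le> u" using z[of u] by force
  show "n < u \<Longrightarrow> u < first_zero n w \<Longrightarrow> one_at n w u" 
    using z[of u] one_at_or_zero_at[of n u w] next_zero(3)[of n n w] by (auto simp: first_zero_def)
qed

lemma zeros_below_next_zero:
  assumes "zero_at n w v" "v \<le> 2 * n"
  shows "zeros_below n w (next_zero n w v) = Suc (zeros_below n w v)"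
  using assms next_zero[OF assms(2)] by (intro zeros_below_next) auto

text \<open>The second zero has rank 1 and hence partner \<open>n\<close>. If all digits are 1, then
  \<open>2 * n\<close> is the one of rank \<open>n - 1\<close>, again with partner
  \<open>n\<close>.\<close>

lemma sip_fun_n:
  assumes "1 \<le> n"
  shows "sip_fun n w n = (if first_zero n w \<le> 2 * n then next_zero n w (first_zero n w) else 2 * n)"
proof (cases "first_zero n w \<le> 2 * n")
  case True
  let ?x = "next_zero n w (first_zero n w)"
  have "zeros_below n w ?x = 1"
    using zeros_below_next_zero[OF first_zero(1) True] zeros_below_first by simp
  then have "sip_fun n w ?x = n" using sip_fun_zero(1)[OF next_zero(1)[OF True]] by simp
  then show ?thesis using sip_fun_invol[of ?x n w] next_zero[OF True, of w] True by simp
next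
  case False
  then have "one_at n w (2 * n)" using first_zero(6)[of n "2 * n" w] assms by simp
  moreover have "zeros_below n w (2 * n) = 0"
    using zeros_below_mono[of "2 * n" "first_zero n w" n w] zeros_below_first[of n w] False by simp
  then have "ones_below n w (2 * n) = n - 1" using below_add[of n "2 * n" w] assms by simp
  ultimately have "sip_fun n w (2 * n) = n" using sip_fun_one(1)[of n w "2 * n"] assms by simp
  then show ?thesis using sip_fun_invol[of "2 * n" n w] False assms by simp
qed

text \<open>A larger element \<open>?y\<close> at an earlier position \<open>u\<close> would have
  more ones below it than \<open>v\<close> has. But \<open>u\<close> bounds that number: it is
  \<open>u - 1\<close> if \<open>?y\<close> is a one, and at most \<open>u - 1\<close> if
  \<open>?y\<close> is a zero.\<close>

lemma target_one:
  assumes v: "one_at n w v"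
  shows "target n w v = 2 * n + 2"
proof (rule target_none)
  have vb: "n < v" "v \<le> 2 * n" using one_at_bounds[OF v] by auto
  then show "1 \<le> v" "v \<le> 2 * n + 1" by auto
  fix u assume u: "1 \<le> u" "u < sip_fun n w v"
  then have ub: "u \<le> n" "u \<le> ones_below n w v" using sip_fun_one[OF v] by auto
  show "sip_fun n w u \<le> v"
  proof (rule ccontr)
    let ?y = "sip_fun n w u"
    assume "\<not> ?y \<le> v"
    then have "v < ?y" by simp
    note less = ones_below_less[OF v this]
    have "ones_below n w ?y + zeros_below n w ?y = ?y - Suc n" "?y \<le> 2 * n + 1" "n < ?y"
      using below_add[of n ?y w] sip_fun_low[OF u(1) ub(1), of w] by auto
    then show False using less ub u
      by (cases rule: sip_fun_cases[OF u(1) ub(1), of w]) auto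
  qed
qed

text \<open>Zeros of rank at least 1 sit at consecutive positions in decreasing order of rank, so
  the next zero is the immediate left neighbour. The first zero is fixed instead; between it and
  position \<open>n\<close> there are only ones, which hold small elements.\<close>

lemma target_zero:
  assumes v: "zero_at n w v" "v \<le> 2 * n"
  shows "target n w v = next_zero n w v"
proof -
  let ?x = "next_zero n w v"
  note x = next_zero[OF v(2), of w]
  have z: "zeros_below n w ?x = Suc (zeros_below n w v)" by (rule zeros_below_next_zero[OF v])
  then have px: "sip_fun n w ?x = n - zeros_below n w v" "Suc (zeros_below n w v) \<le> n"
    using sip_fun_zero[OF x(1)] by auto
  have inv: "sip_fun n w (n - zeros_below n w v) = ?x"
    using sip_fun_invol[of ?x n w] x px by simp
  have "target n w v = sip_fun n w (n - zeros_below n w v)"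
  proof (rule target_eq)
    show "1 \<le> v" "v \<le> 2 * n + 1" using zero_at_bounds[OF v(1)] by auto
    show "1 \<le> n - zeros_below n w v" using px by simp
    show "n - zeros_below n w v < sip_fun n w v"
      using sip_fun_zero(1)[OF v(1)] zero_at_bounds[OF v(1)] px by auto
    show "v < sip_fun n w (n - zeros_below n w v)" using inv x by simp
    fix u assume u: "n - zeros_below n w v < u" "u < sip_fun n w v"
    show "sip_fun n w u \<le> v"
    proof (cases "zeros_below n w v = 0")
      case True
      then have "n < u" "u < v" using u sip_fun_zero(1)[OF v(1)] by auto
      then have "one_at n w u"
        using zeros_below_0D[OF True] one_at_or_zero_at[of n u w] v(2) by auto
      then show ?thesis using sip_fun_one[of n w u] zero_at_bounds[OF v(1)] by auto
    next
      case False
      then show ?thesis using u sip_fun_zero(1)[OF v(1)] by auto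
    qed
  qed
  then show ?thesis using inv by simp
qed

section \<open>Targets of the small elements before and after the first zero\<close>

lemma sip_fun_before_first:
  assumes "1 \<le> i" "n + i < first_zero n w"
  shows "i \<le> n" "sip_fun n w i = n + i"
proof -
  show i: "i \<le> n" using assms first_zero(3)[of n w] by simp
  have "one_at n w (n + i)" using first_zero(6)[of n "n + i" w] assms by simp
  moreover have "zeros_below n w (n + i) = 0"
    using zeros_below_mono[of "n + i" "first_zero n w" n w] zeros_below_first[of n w] assms by simp
  then have "ones_below n w (n + i) = i - 1" using below_add[of n "n + i" w] i assms by simp
  ultimately have "sip_fun n w (n + i) = i" using sip_fun_one(1)[of n w "n + i"] assms by simp
  then show "sip_fun n w i = n + i" using sip_fun_invol[of "n + i" n w] i assms(1) by simp
qed

lemma target_before_first: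
  assumes "1 \<le> i" "n + i < first_zero n w"
  shows "target n w i = (if first_zero n w \<le> 2 * n then next_zero n w (first_zero n w) else 2 * n)"
proof -
  have "target n w i = sip_fun n w n"
    using sip_fun_before_first[OF assms] assms first_zero(4)[of _ n w] by (intro target_low_none) auto
  then show ?thesis using sip_fun_n[of n w] sip_fun_before_first[OF assms] assms by simp
qed

lemma prev_zero:
  assumes "first_zero n w < y" "y \<le> 2 * n + 1"
  obtains v where "zero_at n w v" "v < y" "\<And>u. v < u \<Longrightarrow> u < y \<Longrightarrow> \<not> zero_at n w u"
    "v \<le> 2 * n" 
proof -
  define v where "v = Max {u. u < y \<and> zero_at n w u}"
  have fin: "finite {u. u < y \<and> zero_at n w u}" by simp
  have "v \<in> {u. u < y \<and> zero_at n w u}"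
    unfolding v_def using fin assms first_zero(1) by (intro Max_in) auto
  moreover have "u \<le> v" if "u < y" "zero_at n w u" for u
    unfolding v_def using fin that by (intro Max_ge) auto
  ultimately show ?thesis using that[of v] assms by fastforce
qed

text \<open>With no zero below its position, \<open>i\<close> would be the partner of the one at
  \<open>n + i\<close>. That position is not before the first zero, a contradiction.\<close>

lemma first_zero_less_sip_fun:
  assumes "i \<le> n" "first_zero n w \<le> n + i"
  shows "first_zero n w < sip_fun n w i"
proof (rule ccontr)
  let ?y = "sip_fun n w i"
  have i: "1 \<le> i" using assms(2) first_zero(2)[of n w] by simp
  assume "\<not> ?thesis"
  then have "?y \<le> first_zero n w" by simp
  then have z: "zeros_below n w ?y = 0"
    using zeros_below_mono[of ?y "first_zero n w" n w] zeros_below_first[of n w] by simp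
  have y: "n < ?y" "?y \<le> 2 * n + 1" using sip_fun_low[OF i assms(1)] by auto
  from i assms(1) show False
  proof (cases rule: sip_fun_cases[where w = w])
    case one_at
    then have "?y = n + i" using below_add[of n ?y w] z y by simp
    then show ?thesis using assms(2) one_at \<open>?y \<le> first_zero n w\<close> first_zero(1)[of n w] one_at_not_zero_at[OF one_at(1)] by simp
  next
    case zero_at
    then show ?thesis using z by simp
  qed
qed

text \<open>The target is the partner of the last zero before the position of \<open>i\<close>,
  whose rank is one less than the count there. That partner is the zero itself for the first zero,
  and \<open>n + 1\<close> minus its rank otherwise, which explains \<open>n + 2\<close>.\<close>

lemma target_zeros_below:
  assumes "i \<le> n" "first_zero n w \<le> n + i"
  shows "target n w i = (if zeros_below n w (sip_fun n w i) = 1 then first_zero n w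
      else n + 2 - zeros_below n w (sip_fun n w i))"
    and "1 \<le> zeros_below n w (sip_fun n w i)"
    "zeros_below n w (sip_fun n w i) \<le> n"
proof -
  let ?y = "sip_fun n w i"
  have i: "1 \<le> i" using assms(2) first_zero(2)[of n w] by simp
  have y: "n < ?y" "?y \<le> 2 * n + 1" using sip_fun_low[OF i assms(1)] by auto
  obtain v where v: "zero_at n w v" "v < ?y" "\<And>u. v < u \<Longrightarrow> u < ?y \<Longrightarrow> \<not> zero_at n w u" "v \<le> 2 * n"
    using prev_zero[OF first_zero_less_sip_fun[OF assms] y(2)] by blast
  have z: "zeros_below n w ?y = Suc (zeros_below n w v)" using zeros_below_next[OF v(1-3)] .
  show "1 \<le> zeros_below n w ?y" using z by simp
  from i assms(1) show "zeros_below n w ?y \<le> n"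
  proof (cases rule: sip_fun_cases[where w = w])
    case one_at
    then show ?thesis using below_add[of n ?y w] y one_at_bounds[OF one_at(1)] by linarith
  qed
  have "target n w i = sip_fun n w v" using target_low_zero[OF i assms(1) v(1-3)] .
  moreover have "v = first_zero n w" if "zeros_below n w v = 0"
    using zeros_below_0D[OF that, of "first_zero n w"] first_zero(1)[of n w] first_zero(5)[OF v(1)] by fastforce
  ultimately show "target n w i = (if zeros_below n w ?y = 1 then first_zero n w
      else n + 2 - zeros_below n w ?y)"
    using sip_fun_zero[OF v(1)] z by auto
qed

lemma target_after_first:
  assumes "i \<le> n" "first_zero n w \<le> n + i"
  shows "target n w i = first_zero n w \<or> target n w i \<le> n"
  using target_zeros_below[OF assms] by auto

text \<open>The element on the left points to its own successor, wherever the zero lies. Such an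
  edge reveals only that there are enough zeros.\<close>

lemma target_index_zero:
  assumes "zero_at n w v" "2 \<le> zeros_below n w v"
  shows "target n w (Suc n - zeros_below n w v) = n + 2 - zeros_below n w v"
proof -
  let ?i = "Suc n - zeros_below n w v"
  have v: "sip_fun n w v = ?i" "zeros_below n w v \<le> n" using sip_fun_zero[OF assms(1)] assms(2) by auto
  then have y: "sip_fun n w ?i = v"
    using sip_fun_invol[of v n w] zero_at_bounds[OF assms(1)] by simp
  have "first_zero n w \<le> n + ?i"
  proof (rule ccontr)
    assume "\<not> ?thesis"
    then have "sip_fun n w ?i = n + ?i" "n + ?i < first_zero n w"
      using sip_fun_before_first[of ?i n w] v(2) by auto
    then show False using y first_zero(4) assms(1) by metis
  qed
  then show ?thesis using target_zeros_below[of ?i n w] y assms(2) v(2) by simp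
qed

lemma target_index_one:
  assumes "one_at n w v" "2 \<le> zeros_below n w v"
  shows "target n w (Suc (ones_below n w v)) = n + 2 - zeros_below n w v"
proof -
  let ?i = "Suc (ones_below n w v)"
  have v: "sip_fun n w v = ?i" "?i \<le> n" using sip_fun_one[OF assms(1)] by auto
  then have y: "sip_fun n w ?i = v"
    using sip_fun_invol[of v n w] one_at_bounds[OF assms(1)] by simp
  have "first_zero n w \<le> n + ?i"
  proof (rule ccontr)
    assume "\<not> ?thesis"
    then have "sip_fun n w ?i = n + ?i" "n + ?i < first_zero n w"
      using sip_fun_before_first[of ?i n w] v(2) by auto
    then have "zeros_below n w v = 0"
      using y zeros_below_mono[of v "first_zero n w" n w] zeros_below_first[of n w] by simp
    then show False using assms by simp
  qed
  then show ?thesis using target_zeros_below[of ?i n w] y assms(2) v(2) by simp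
qed

lemma target_n:
  assumes "first_zero n w \<le> 2 * n"
  shows "target n w n = first_zero n w"
proof -
  have n: "1 \<le> n" using assms first_zero(2)[of n w] by simp
  have "zeros_below n w (next_zero n w (first_zero n w)) = 1"
    using zeros_below_next_zero[OF first_zero(1) assms] zeros_below_first by simp
  then show ?thesis using target_zeros_below(1)[of n n w] sip_fun_n[OF n, of w] assms by simp
qed

text \<open>The third zero, at worst the permanent one, has rank 2 and partner
  \<open>n - 1\<close>.\<close>

lemma target_n_minus_1:
  assumes "first_zero n w \<le> 2 * n" "next_zero n w (first_zero n w) \<le> 2 * n"
  shows "target n w (n - 1) = n"
proof -
  let ?x = "next_zero n w (first_zero n w)"
  have "zeros_below n w (next_zero n w ?x) = 2"
    using zeros_below_next_zero[OF next_zero(1)[OF assms(1)] assms(2)]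
      zeros_below_next_zero[OF first_zero(1) assms(1)] zeros_below_first by simp
  then show ?thesis using target_index_zero[OF next_zero(1)[OF assms(2), of w]] by simp
qed

lemma target_n_minus_2:
  assumes "first_zero n w \<le> 2 * n" "next_zero n w (first_zero n w) \<le> 2 * n"
    "next_zero n w (next_zero n w (first_zero n w)) \<le> 2 * n"
  shows "target n w (n - 2) = n - 1"
proof -
  let ?x = "next_zero n w (next_zero n w (first_zero n w))"
  have "zeros_below n w (next_zero n w ?x) = 3"
    using zeros_below_next_zero[OF next_zero(1)[OF assms(2)] assms(3)]
      zeros_below_next_zero[OF next_zero(1)[OF assms(1)] assms(2)]
      zeros_below_next_zero[OF first_zero(1) assms(1)] zeros_below_first by simp
  then show ?thesis using target_index_zero[OF next_zero(1)[OF assms(3), of w]] by simp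
qed

section \<open>Counting modified edges\<close>

lemma target_last: "target n w (2 * n + 1) = 2 * n + 2"
proof (rule target_none)
  fix u assume u: "1 \<le> u" "u < sip_fun n w (2 * n + 1)"
  then have "u \<le> 2 * n + 1" using sip_fun_range[of "2 * n + 1" n w] by simp
  then show "sip_fun n w u \<le> 2 * n + 1" using sip_fun_range u by blast
qed auto

lemma edge_mods_ge:
  assumes "\<And>i. i \<in> S \<Longrightarrow> 1 \<le> i \<and> i \<le> 2 * n + 1 \<and> target n w i \<noteq> target n w' i" "card S = k"
  shows "k \<le> edge_mods n w w'"
proof -
  have "S \<subseteq> {i \<in> {1..2 * n + 1}. target n w i \<noteq> target n w' i}" using assms(1) by auto
  then show ?thesis unfolding edge_mods_def assms(2)[symmetric] by (intro card_mono) auto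
qed

lemma edge_mods_le:
  assumes "\<And>i. 1 \<le> i \<Longrightarrow> i \<le> 2 * n \<Longrightarrow> i \<notin> S \<Longrightarrow> target n w i = target n w' i" "finite S" "card S \<le> k"
  shows "edge_mods n w w' \<le> k"
proof -
  have "{i \<in> {1..2 * n + 1}. target n w i \<noteq> target n w' i} \<subseteq> S"
  proof
    fix i assume i: "i \<in> {i \<in> {1..2 * n + 1}. target n w i \<noteq> target n w' i}"
    then have "i \<noteq> 2 * n + 1" using target_last[of n w] target_last[of n w'] by auto
    then show "i \<in> S" using i assms(1)[of i] by auto
  qed
  then have "card {i \<in> {1..2 * n + 1}. target n w i \<noteq> target n w' i} \<le> card S"
    using assms(2) by (intro card_mono)
  then show ?thesis unfolding edge_mods_def using assms(3) by simp
qed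

lemma edge_mods_commute: "edge_mods n w w' = edge_mods n w' w"
  unfolding edge_mods_def by (intro arg_cong[where f = card]) auto

lemma minVM_eqI:
  assumes "w' \<in> codec_range n" "w' \<noteq> w" "edge_mods n w w' \<le> k"
    and "\<And>v. v \<in> codec_range n \<Longrightarrow> v \<noteq> w \<Longrightarrow> k \<le> edge_mods n w v"
  shows "minVM n w = k"
  unfolding minVM_def
proof (rule Min_eqI)
  show "finite (edge_mods n w ` (codec_range n - {w}))" by (simp add: codec_range_def)
  show "k \<le> y" if "y \<in> edge_mods n w ` (codec_range n - {w})" for y
    using that assms(4) by auto
  have "edge_mods n w w' = k" using assms by (simp add: le_antisym)
  then show "k \<in> edge_mods n w ` (codec_range n - {w})" using assms(1,2) by auto
qed

section \<open>Numbers as sets of zero positions\<close>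

lemma codec_range_bits:
  assumes "1 \<le> n"
  shows "w \<in> codec_range n \<longleftrightarrow> bit w (n - 1) \<and> (\<forall>k \<ge> n. \<not> bit w k)"
proof
  assume w: "w \<in> codec_range n"
  have "(0::nat) < 2 ^ n" by simp
  then have w': "2 ^ (n - 1) \<le> w" "w < 2 ^ n" using w unfolding codec_range_def atLeastAtMost_iff by linarith+
  then have *: "take_bit n w = w" by (simp add: take_bit_nat_eq_self)
  have hi: "\<forall>k \<ge> n. \<not> bit w k" by (metis * bit_take_bit_iff not_less)
  have "bit w (n - 1)"
  proof (rule ccontr)
    assume "\<not> bit w (n - 1)"
    then have top: "\<not> bit w k" if "n - 1 \<le> k" for k
      using hi that by (cases "k = n - 1") auto
    have "take_bit (n - 1) w = w"
    proof (rule bit_eqI)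
      show "bit (take_bit (n - 1) w) k \<longleftrightarrow> bit w k" for k
        using top[of k] by (cases "k < n - 1") (auto simp: bit_take_bit_iff)
    qed
    then show False using w'(1) take_bit_nat_less_exp[of "n - 1" w] by simp
  qed
  with hi show "bit w (n - 1) \<and> (\<forall>k \<ge> n. \<not> bit w k)" by simp
next
  assume w: "bit w (n - 1) \<and> (\<forall>k \<ge> n. \<not> bit w k)"
  then have "take_bit n w = w" by (intro bit_eqI) (metis bit_take_bit_iff not_less)
  then have "w < 2 ^ n" by (metis take_bit_nat_less_exp)
  moreover have "2 ^ (n - 1) \<le> w"
  proof (rule ccontr)
    assume "\<not> ?thesis"
    then have "take_bit (n - 1) w = w" by (simp add: take_bit_nat_eq_self)
    then show False using w by (metis bit_take_bit_iff less_irrefl)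
  qed
  ultimately show "w \<in> codec_range n" by (auto simp: codec_range_def)
qed

text \<open>Only the \<open>n\<close> digit positions are constrained: the permanent zero is never
  listed, and members of \<open>Z\<close> outside this range have no effect.\<close>

definition zeros_at :: "nat \<Rightarrow> nat \<Rightarrow> nat set \<Rightarrow> bool" where
  "zeros_at n w Z \<longleftrightarrow> (\<forall>v. n < v \<longrightarrow> v \<le> 2 * n \<longrightarrow> (zero_at n w v \<longleftrightarrow> v \<in> Z))"

lemma zeros_at_unique:
  assumes "1 \<le> n" "w \<in> codec_range n" "w' \<in> codec_range n" "zeros_at n w Z" "zeros_at n w' Z"
  shows "w = w'"
proof (rule bit_eqI)
  fix k
  show "bit w k \<longleftrightarrow> bit w' k"
  proof (cases "k < n")
    case True
    then have "zero_at n w (2 * n - k) \<longleftrightarrow> zero_at n w' (2 * n - k)"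
      using assms(4,5) by (simp add: zeros_at_def)
    moreover have "zero_at n v (2 * n - k) \<longleftrightarrow> \<not> bit v k" for v
      using True by (auto simp: zero_at_def one_at_def)
    ultimately show ?thesis by simp
  next
    case False
    then show ?thesis using assms by (simp add: codec_range_bits)
  qed
qed

lemma zero_at_eq_unique:
  assumes "1 \<le> n" "w \<in> codec_range n" "w' \<in> codec_range n"
    "\<And>v. n < v \<Longrightarrow> v \<le> 2 * n \<Longrightarrow> zero_at n w v \<longleftrightarrow> zero_at n w' v"
  shows "w = w'"
  using assms by (intro zeros_at_unique[of n w w' "Collect (zero_at n w)"]) (auto simp: zeros_at_def)

text \<open>Position \<open>n + 1\<close> carries the leading digit, which must be 1, so an
  admissible set starts at \<open>n + 2\<close>. The Horner sum assembles the number from its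
  bits.\<close>

lemma zeros_at_exists:
  assumes "1 \<le> n" "Z \<subseteq> {n + 2..}"
  shows "\<exists>w \<in> codec_range n. zeros_at n w Z"
proof
  define w :: nat where "w = horner_sum of_bool 2 (map (\<lambda>k. 2 * n - k \<notin> Z) [0..<n])"
  have b: "bit w k \<longleftrightarrow> k < n \<and> 2 * n - k \<notin> Z" for k
    by (auto simp: w_def bit_horner_sum_bit_iff)
  have "2 * n - (n - 1) = n + 1" using assms(1) by simp
  then have "2 * n - (n - 1) \<notin> Z" using assms(2) by auto
  then show "w \<in> codec_range n" using assms(1) by (simp add: codec_range_bits b)
  show "zeros_at n w Z" by (auto simp: zeros_at_def zero_at_def one_at_def b)
qed

lemma first_zero_gt:
  assumes "1 \<le> n" "w \<in> codec_range n"
  shows "n + 1 < first_zero n w"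
proof -
  have "one_at n w (n + 1)" using assms by (simp add: one_at_def codec_range_bits)
  then have "first_zero n w \<noteq> n + 1" using first_zero(1)[of n w] one_at_not_zero_at by metis
  then show ?thesis using first_zero(2)[of n w] by linarith
qed

lemma first_zero_eqI:
  assumes "zero_at n w x" "\<And>v. n < v \<Longrightarrow> v < x \<Longrightarrow> \<not> zero_at n w v"
  shows "first_zero n w = x"
  using assms zero_at_bounds[OF assms(1)] unfolding first_zero_def by (intro next_zero_eqI) auto

lemma target_differ:
  assumes "n < v" "v \<le> 2 * n" "zero_at n w v \<noteq> zero_at n w' v"
  shows "target n w v \<noteq> target n w' v"
proof -
  have *: "target n u v \<noteq> target n u' v" if "zero_at n u v" "\<not> zero_at n u' v" for u u'
    using that target_zero[of n u v] target_one[of n u' v] next_zero(3)[OF assms(2), of u] assms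
      one_at_or_zero_at[of n v u'] by auto
  show ?thesis using assms(3) *[of w w'] *[of w' w] by metis
qed

lemma target_same:
  assumes "n < v" "v \<le> 2 * n" "\<not> zero_at n w v" "\<not> zero_at n w' v"
  shows "target n w v = target n w' v"
proof -
  have "one_at n w v" "one_at n w' v" using assms one_at_or_zero_at[of n v] by auto
  then show ?thesis using target_one by metis
qed


section \<open>Explicit targets for at most two digits 0\<close>

lemma first_zero_none:
  assumes "zeros_at n w {}"
  shows "first_zero n w = 2 * n + 1"
  using assms by (intro first_zero_eqI) (auto simp: zeros_at_def)

lemma target_none_low:
  assumes "zeros_at n w {}" "1 \<le> i" "i \<le> n"
  shows "target n w i = 2 * n"
  using target_before_first[of i n w] first_zero_none[OF assms(1)] assms by simp

lemma zeros_at_next_last: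
  assumes "zero_at n w x" "x \<le> 2 * n" "\<And>v. x < v \<Longrightarrow> v \<le> 2 * n \<Longrightarrow> \<not> zero_at n w v"
  shows "next_zero n w x = 2 * n + 1"
  using assms by (intro next_zero_eqI) auto

lemma first_zero_single:
  assumes "zeros_at n w {x}" "n < x" "x \<le> 2 * n"
  shows "first_zero n w = x" "next_zero n w x = 2 * n + 1"
proof -
  have z: "zero_at n w v \<longleftrightarrow> v = x" if "n < v" "v \<le> 2 * n" for v
    using assms(1) that by (simp add: zeros_at_def)
  show "first_zero n w = x" using assms by (intro first_zero_eqI) (auto simp: z)
  show "next_zero n w x = 2 * n + 1" using assms by (intro zeros_at_next_last) (auto simp: z)
qed

lemma target_single:
  assumes "zeros_at n w {x}" "n < x" "x \<le> 2 * n" "1 \<le> i" "i \<le> n"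
  shows "target n w i = (if n + i < x then 2 * n + 1 else x)"
proof (cases "n + i < x")
  case True
  then show ?thesis using target_before_first[of i n w] first_zero_single[OF assms(1-3)] assms(3,4) by simp
next
  case False
  let ?y = "sip_fun n w i"
  \<comment> \<open>Since \<open>?y\<close> is at most \<open>2 * n + 1\<close>, the permanent zero
    is not strictly below it.\<close>
  have "{u. u < ?y \<and> zero_at n w u} \<subseteq> {x}"
  proof
    fix u assume "u \<in> {u. u < ?y \<and> zero_at n w u}"
    then have "zero_at n w u" "n < u" "u \<le> 2 * n"
      using sip_fun_low[OF assms(4,5), of w] zero_at_bounds[of n w u] by auto
    then show "u \<in> {x}" using assms(1) unfolding zeros_at_def by blast
  qed
  then have "zeros_below n w ?y \<le> 1"
    unfolding zeros_below_def using card_mono[of "{x}"] by fastforce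
  then show ?thesis
    using target_zeros_below[of i n w] first_zero_single[OF assms(1-3)] assms(5) False by simp
qed

lemma first_zero_double:
  assumes "zeros_at n w {x, 2 * n}" "n < x" "x < 2 * n"
  shows "first_zero n w = x" "next_zero n w x = 2 * n" "next_zero n w (2 * n) = 2 * n + 1"
proof -
  have z: "zero_at n w v \<longleftrightarrow> v = x \<or> v = 2 * n" if "n < v" "v \<le> 2 * n" for v
    using assms(1) that by (simp add: zeros_at_def)
  show "first_zero n w = x" using assms by (intro first_zero_eqI) (auto simp: z)
  show "next_zero n w x = 2 * n" using assms by (intro next_zero_eqI) (auto simp: z)
  show "next_zero n w (2 * n) = 2 * n + 1" using assms by (intro zeros_at_next_last) (auto simp: z)
qed

lemma target_double:
  assumes "zeros_at n w {x, 2 * n}" "n < x" "x < 2 * n" "1 \<le> i" "i \<le> n"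
  shows "target n w i = (if n + i < x then 2 * n else if i = n - 1 then n else x)"
proof -
  note fz = first_zero_double[OF assms(1-3)]
  have n1: "target n w (n - 1) = n" using target_n_minus_1[of n w] fz assms(3) by simp
  have zx: "zeros_below n w x = 0" using zeros_below_first[of n w] fz by simp
  have "zero_at n w x" using first_zero(1)[of n w] fz by simp
  then have "zeros_below n w (2 * n) = 1" using zeros_below_next_zero[of n w x] fz zx assms by simp
  moreover have "zero_at n w (2 * n)" using next_zero(1)[of x n w] fz assms by simp
  ultimately have "zeros_below n w (2 * n + 1) = 2"
    using zeros_below_next_zero[of n w "2 * n"] fz zx assms by simp
  then have last: "sip_fun n w (2 * n + 1) = n - 1"
    using sip_fun_zero(1)[of n w "2 * n + 1"] by simp
  consider "n + i < x" | "\<not> n + i < x" "i = n - 1" | "\<not> n + i < x" "i \<noteq> n - 1" by blast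
  then show ?thesis
  proof cases
    case 1
    then show ?thesis using target_before_first[of i n w] fz assms(3,4) by simp
  next
    case 2
    then show ?thesis using n1 by simp
  next
    case 3
    let ?y = "sip_fun n w i"
    \<comment> \<open>The permanent zero holds \<open>n - 1\<close>, so every other \<open>i\<close>
      sits at most at \<open>2 * n\<close>. Then the zero at \<open>2 * n\<close> is not strictly
      below it either, and the count is at most 1.\<close>
    have "?y \<noteq> 2 * n + 1" using last 3 sip_fun_invol[of i n w] assms by auto
    then have y: "?y \<le> 2 * n" using sip_fun_low[OF assms(4,5), of w] by simp
    have "{u. u < ?y \<and> zero_at n w u} \<subseteq> {x}"
    proof
      fix u assume "u \<in> {u. u < ?y \<and> zero_at n w u}"
      then have "zero_at n w u" "n < u" "u < 2 * n"
        using y zero_at_bounds[of n w u] by auto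
      then have "u \<in> {x, 2 * n}" using assms(1) unfolding zeros_at_def by auto
      then show "u \<in> {x}" using \<open>u < 2 * n\<close> by simp
    qed
    then have "zeros_below n w ?y \<le> 1"
      unfolding zeros_below_def using card_mono[of "{x}"] by fastforce
    then show ?thesis
      using target_zeros_below[of i n w] fz assms(5) 3 by simp
  qed
qed

section \<open>Numbers with no internal zero: lower bounds\<close>

lemma edge_mods_ge_4:
  assumes "distinct [a, b, c, d]" "{a, b, c, d} \<subseteq> {1..2 * n + 1}"
    and "target n w a \<noteq> target n w' a" "target n w b \<noteq> target n w' b" "target n w c \<noteq> target n w' c" "target n w d \<noteq> target n w' d"
  shows "4 \<le> edge_mods n w w'"
proof (rule edge_mods_ge[where S = "{a, b, c, d}"])
  show "card {a, b, c, d} = 4" using distinct_card[OF assms(1)] by simp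
  show "1 \<le> i \<and> i \<le> 2 * n + 1 \<and> target n w i \<noteq> target n w' i" if "i \<in> {a, b, c, d}" for i
  proof (intro conjI)
    show "1 \<le> i" "i \<le> 2 * n + 1" using that assms(2) by auto
    show "target n w i \<noteq> target n w' i" using that assms(3-6) by blast
  qed
qed

lemma zeros_atI_none:
  assumes "first_zero n w = 2 * n + 1"
  shows "zeros_at n w {}"
  using first_zero(4)[of _ n w] assms by (simp add: zeros_at_def)

lemma zeros_atI_single:
  assumes "first_zero n w = x" "x \<le> 2 * n" "next_zero n w x = 2 * n + 1"
  shows "zeros_at n w {x}"
  unfolding zeros_at_def
proof (intro allI impI)
  fix v assume v: "n < v" "v \<le> 2 * n"
  show "zero_at n w v \<longleftrightarrow> v \<in> {x}"
    using first_zero(1)[of n w] first_zero(4)[of v n w] next_zero(5)[OF assms(2), of v w] assms v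
    by (cases v x rule: linorder_cases) auto
qed

lemma zeros_atI_double:
  assumes "first_zero n w = x" "x < 2 * n" "next_zero n w x = 2 * n"
  shows "zeros_at n w {x, 2 * n}"
  unfolding zeros_at_def
proof (intro allI impI)
  fix v assume v: "n < v" "v \<le> 2 * n"
  have x: "zero_at n w x" "\<And>u. u < x \<Longrightarrow> \<not> zero_at n w u" using first_zero(1)[of n w] first_zero(4)[of _ n w] assms(1) by auto
  have y: "zero_at n w (2 * n)" "\<And>u. x < u \<Longrightarrow> u < 2 * n \<Longrightarrow> \<not> zero_at n w u"
    using next_zero(1)[of x n w] next_zero(5)[of x n _ w] assms(2,3) by auto
  show "zero_at n w v \<longleftrightarrow> v \<in> {x, 2 * n}"
    using x y(1) y(2)[of v] v by (cases v x rule: linorder_cases; cases "v = 2 * n") auto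
qed

lemma zeros_at_differ:
  assumes "zeros_at n w Z" "v \<in> Z" "n < v" "v \<le> 2 * n" "\<not> zero_at n w' v"
  shows "target n w v \<noteq> target n w' v"
  using target_differ[of n v w w'] assms by (auto simp: zeros_at_def)

lemma zeros_at_differ':
  assumes "zeros_at n w Z" "v \<notin> Z" "n < v" "v \<le> 2 * n" "zero_at n w' v"
  shows "target n w v \<noteq> target n w' v"
  using target_differ[of n v w w'] assms by (auto simp: zeros_at_def)

lemma zeros_at_same:
  assumes "zeros_at n w Z" "zeros_at n w' Z'" "n < v" "v \<le> 2 * n" "v \<notin> Z" "v \<notin> Z'"
  shows "target n w v = target n w' v"
  using target_same[of n v w w'] assms by (auto simp: zeros_at_def)

lemma ge_none_single:
  assumes "zeros_at n w {}" "zeros_at n w' {x}" "n < x" "x < 2 * n"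
  shows "n + 1 \<le> edge_mods n w w'"
proof (rule edge_mods_ge[where S = "{1..n} \<union> {x}"])
  show "card ({1..n} \<union> {x}) = n + 1" using assms by simp
  have hi: "target n w x \<noteq> target n w' x"
    using zeros_at_differ[OF assms(2), of x w] assms(1,3,4) by (simp add: zeros_at_def)
  have lo: "target n w i \<noteq> target n w' i" if "1 \<le> i" "i \<le> n" for i
    using target_none_low[OF assms(1) that] target_single[OF assms(2,3) _ that] assms(4) by simp
  show "1 \<le> i \<and> i \<le> 2 * n + 1 \<and> target n w i \<noteq> target n w' i" if "i \<in> {1..n} \<union> {x}" for i
    using that hi lo[of i] assms(3,4) by auto
qed

text \<open>The element \<open>n\<close> is left out of the set because it points to
  \<open>2 * n\<close> in both words.\<close>

lemma ge_none_last:
  assumes "1 \<le> n" "zeros_at n w {}" "zeros_at n w' {2 * n}"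
  shows "n \<le> edge_mods n w w'"
proof (rule edge_mods_ge[where S = "{1..n - 1} \<union> {2 * n}"])
  show "card ({1..n - 1} \<union> {2 * n}) = n" using assms(1) by (subst card_Un_disjoint) auto
  have hi: "target n w (2 * n) \<noteq> target n w' (2 * n)"
    using zeros_at_differ[OF assms(3), of "2 * n" w] assms(1,2) by (simp add: zeros_at_def)
  have lo: "target n w i \<noteq> target n w' i" if "1 \<le> i" "i \<le> n - 1" for i
    using target_none_low[OF assms(2), of i] target_single[OF assms(3), of i] that by simp
  show "1 \<le> i \<and> i \<le> 2 * n + 1 \<and> target n w i \<noteq> target n w' i" if "i \<in> {1..n - 1} \<union> {2 * n}" for i
    using that hi lo[of i] assms(1) by auto
qed

text \<open>Two zeros among the digits of \<open>w'\<close> pull the targets of \<open>n\<close> and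
  \<open>n - 1\<close> down to \<open>x\<close> and \<open>n\<close>, both below
  \<open>2 * n\<close>, and the two flipped digits complete the four. With a single zero nearly all
  small elements change.\<close>

lemma lower_none:
  assumes "4 \<le> n" "zeros_at n w {}" "w \<in> codec_range n" "w' \<in> codec_range n" "w' \<noteq> w"
  shows "4 \<le> edge_mods n w w'"
proof -
  define x where "x = first_zero n w'"
  define y where "y = next_zero n w' x"
  have n: "1 \<le> n" using assms(1) by simp
  have x: "n + 1 < x" "x \<le> 2 * n + 1" "zero_at n w' x"
    using first_zero_gt[OF n assms(4)] first_zero[of n w'] unfolding x_def by auto
  have "x \<noteq> 2 * n + 1"
    using zeros_at_unique[OF n assms(4,3) zeros_atI_none assms(2)] assms(5) x_def by auto
  then have x2: "x \<le> 2 * n" using x by simp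
  note y = next_zero[OF x2, of w', folded y_def]
  show ?thesis
  proof (cases "y \<le> 2 * n")
    case False
    then have "y = 2 * n + 1" using y by simp
    then have s: "zeros_at n w' {x}" using zeros_atI_single[of n w' x] x2 by (simp add: x_def y_def)
    show ?thesis
    proof (cases "x = 2 * n")
      case True
      then show ?thesis using ge_none_last[OF n assms(2) s[unfolded True]] assms(1) by simp
    next
      case False
      then show ?thesis using ge_none_single[OF assms(2) s] x x2 assms(1) by simp
    qed
  next
    case True
    have d: "target n w n \<noteq> target n w' n" "target n w (n - 1) \<noteq> target n w' (n - 1)"
      using target_none_low[OF assms(2), of n] target_none_low[OF assms(2), of "n - 1"] target_n[of n w']
        target_n_minus_1[of n w'] x2 y True assms(1) by (auto simp: x_def y_def)
    have h: "target n w x \<noteq> target n w' x" "target n w y \<noteq> target n w' y"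
      using zeros_at_differ'[OF assms(2), of _ w'] x x2 y True by auto
    have "distinct [n, n - 1, x, y]" "{n, n - 1, x, y} \<subseteq> {1..2 * n + 1}"
      using x(1,2) y(2,3) assms(1) by auto
    then show ?thesis using d h by (rule edge_mods_ge_4)
  qed
qed

lemma lower_last:
  assumes "4 \<le> n" "zeros_at n w {2 * n}" "w \<in> codec_range n" "w' \<in> codec_range n" "w' \<noteq> w"
  shows "4 \<le> edge_mods n w w'"
proof -
  define x where "x = first_zero n w'"
  define y where "y = next_zero n w' x"
  have n: "1 \<le> n" using assms(1) by simp
  have x: "n + 1 < x" "x \<le> 2 * n + 1" "zero_at n w' x"
    using first_zero_gt[OF n assms(4)] first_zero[of n w'] unfolding x_def by auto
  note Pw = target_single[OF assms(2)]
  show ?thesis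
  proof (cases "x \<le> 2 * n")
    case False
    then have "zeros_at n w' {}" using zeros_atI_none[of n w'] x by (simp add: x_def)
    then show ?thesis using ge_none_last[OF n _ assms(2), of w'] edge_mods_commute[of n w w'] assms(1) by simp
  next
    case True
    note y = next_zero[OF True, of w', folded y_def]
    have "x \<noteq> 2 * n"
    proof
      assume "x = 2 * n"
      moreover from this have "y = 2 * n + 1" using y by simp
      ultimately have "zeros_at n w' {2 * n}" using zeros_atI_single[of n w' x] by (simp add: x_def y_def)
      then show False using zeros_at_unique[OF n assms(4,3) _ assms(2)] assms(5) by simp
    qed
    then have x2: "x < 2 * n" using True by simp
    have dn: "target n w n \<noteq> target n w' n" using Pw[of n] target_n[of n w'] x2 n by (simp add: x_def)
    have dx: "target n w x \<noteq> target n w' x" using zeros_at_differ'[OF assms(2), of x w'] x x2 by auto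
    show ?thesis
    proof (cases "y \<le> 2 * n")
      case False
      then have "y = 2 * n + 1" using y by simp
      then have s: "zeros_at n w' {x}" using zeros_atI_single[of n w' x] x2 by (simp add: x_def y_def)
      have d1: "target n w (n - 1) \<noteq> target n w' (n - 1)"
        using Pw[of "n - 1"] target_single[OF s, of "n - 1"] x x2 assms(1) by auto
      have "\<not> zero_at n w' (2 * n)" using s x2 n by (simp add: zeros_at_def)
      then have d2: "target n w (2 * n) \<noteq> target n w' (2 * n)"
        using zeros_at_differ[OF assms(2), of "2 * n" w'] n by simp
      have "distinct [n, n - 1, x, 2 * n]" "{n, n - 1, x, 2 * n} \<subseteq> {1..2 * n + 1}"
        using x(1) x2 assms(1) by auto
      then show ?thesis using dn d1 dx d2 by (rule edge_mods_ge_4)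
    next
      case y2: True
      have d1: "target n w (n - 1) \<noteq> target n w' (n - 1)"
        using Pw[of "n - 1"] target_n_minus_1[of n w'] x2 y2 assms(1) by (simp add: x_def y_def)
      \<comment> \<open>The edges at \<open>n\<close>, \<open>n - 1\<close> and \<open>x\<close>
        change already. If the second zero of \<open>w'\<close> is \<open>2 * n\<close>, then 1
        points there instead of to \<open>2 * n + 1\<close>; otherwise the digit at \<open>y\<close>
        is flipped.\<close>
      have "\<exists>j. (j = 1 \<or> j = 2 * n \<or> j = y \<and> y < 2 * n) \<and> target n w j \<noteq> target n w' j"
      proof (cases "y = 2 * n")
        case True
        then have "target n w 1 \<noteq> target n w' 1"
          using Pw[of 1] target_before_first[of 1 n w'] x x2 assms(1) by (simp add: x_def y_def)
        then show ?thesis by blast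
      next
        case False
        then have "target n w y \<noteq> target n w' y"
          using zeros_at_differ'[OF assms(2), of y w'] y y2 by simp
        then show ?thesis using False y2 by auto
      qed
      then obtain j where j: "j = 1 \<or> j = 2 * n \<or> j = y \<and> y < 2 * n" "target n w j \<noteq> target n w' j" by blast
      have "j \<notin> {n, n - 1, x}" "1 \<le> j" "j \<le> 2 * n + 1" using j(1) x(1) x2 y(2,4) assms(1) by auto
      then have "distinct [n, n - 1, x, j]" "{n, n - 1, x, j} \<subseteq> {1..2 * n + 1}"
        using x(1) x2 assms(1) by auto
      then show ?thesis using dn d1 dx j(2) by (rule edge_mods_ge_4)
    qed
  qed
qed

section \<open>Numbers with one_at internal zero: lower bounds\<close>

lemma lower_single:
  assumes "zeros_at n w {x}" "n + 1 < x" "x < 2 * n"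
    and "w \<in> codec_range n" "w' \<in> codec_range n" "w' \<noteq> w"
  shows "min (x - n + 2) (2 * n + 3 - x) \<le> edge_mods n w w'"
proof -
  define x' where "x' = first_zero n w'"
  define y' where "y' = next_zero n w' x'"
  have n: "1 \<le> n" using assms(2,3) by simp
  have x': "n + 1 < x'" "x' \<le> 2 * n + 1" "zero_at n w' x'"
    using first_zero_gt[OF n assms(5)] first_zero[of n w'] unfolding x'_def by auto
  have Pw: "target n w i = (if n + i < x then 2 * n + 1 else x)" if "1 \<le> i" "i \<le> n" for i
    using target_single[OF assms(1) _ _ that] assms(2,3) by simp
  show ?thesis
  proof (cases "x' \<le> 2 * n")
    case False
    then have "zeros_at n w' {}" using zeros_atI_none[of n w'] x' by (simp add: x'_def)
    then have "n + 1 \<le> edge_mods n w w'"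
      using ge_none_single[OF _ assms(1)] edge_mods_commute[of n w w'] assms by simp
    then show ?thesis using assms by linarith
  next
    case x2: True
    note y' = next_zero[OF x2, of w', folded y'_def]
    have before: "target n w' i = y'" if "1 \<le> i" "n + i < x'" for i
      using target_before_first[of i n w'] that x2 by (simp add: x'_def y'_def)
    have after: "target n w' i = x' \<or> target n w' i \<le> n" if "i \<le> n" "x' \<le> n + i" for i
      using target_after_first[of i n w'] that by (simp add: x'_def)
    \<comment> \<open>In \<open>w\<close> these elements point to \<open>x\<close>. In
      \<open>w'\<close> those before the first zero point to \<open>y'\<close>, which then lies
      beyond \<open>x\<close>, and the others to \<open>x'\<close> or to a small element.\<close>
    have low: "target n w i \<noteq> target n w' i" if "x' \<noteq> x" "x - n \<le> i" "i \<le> n" for i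
      using Pw[of i] before[of i] after[of i] that y' assms(2,3) by (cases "n + i < x'") auto
    have hx': "target n w x' \<noteq> target n w' x'" if "x' \<noteq> x"
      using zeros_at_differ'[OF assms(1), of x' w'] that x' x2 by auto
    consider "x < x'" | "x' < x" | "x' = x" by linarith
    then show ?thesis
    proof cases
      case 1
      have hx: "target n w x \<noteq> target n w' x"
        using zeros_at_differ[OF assms(1), of x w'] first_zero(4)[of x n w'] 1 assms(2,3)
        by (simp add: x'_def)
      have "2 * n + 3 - x \<le> edge_mods n w w'"
      proof (rule edge_mods_ge[where S = "{x - n..n} \<union> {x, x'}"])
        show "card ({x - n..n} \<union> {x, x'}) = 2 * n + 3 - x"
          using 1 assms(2,3) x' by (subst card_Un_disjoint) auto
        show "1 \<le> i \<and> i \<le> 2 * n + 1 \<and> target n w i \<noteq> target n w' i" if "i \<in> {x - n..n} \<union> {x, x'}" for i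
          using that low[of i] hx hx' 1 assms(2,3) x' x2 by auto
      qed
      then show ?thesis by simp
    next
      case 2
      \<comment> \<open>If the first zero moves to the left, \<open>x\<close> may remain a zero and
        keep its edge. The element \<open>x - n - 1\<close> compensates: it belongs to the elements
        before the first zero in \<open>w\<close> but not in \<open>w'\<close>.\<close>
      have e: "1 \<le> x - n - 1" "x - n - 1 \<le> n" "n + (x - n - 1) < x" "x' \<le> n + (x - n - 1)"
        using 2 assms(2,3) x' by linarith+
      have l1: "target n w (x - n - 1) \<noteq> target n w' (x - n - 1)"
        using Pw[OF e(1,2)] e(3) after[OF e(2,4)] 2 assms(2,3) by auto
      have low': "target n w i \<noteq> target n w' i" if "x - n - 1 \<le> i" "i \<le> n" for i
        using low[of i] l1 2 that by (cases "i = x - n - 1") auto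
      have "2 * n + 3 - x \<le> edge_mods n w w'"
      proof (rule edge_mods_ge[where S = "{x - n - 1..n} \<union> {x'}"])
        show "card ({x - n - 1..n} \<union> {x'}) = 2 * n + 3 - x"
          using 2 assms(2,3) x' by (subst card_Un_disjoint) auto
        show "1 \<le> i \<and> i \<le> 2 * n + 1 \<and> target n w i \<noteq> target n w' i" if "i \<in> {x - n - 1..n} \<union> {x'}" for i
          using that low'[of i] hx' 2 assms(2,3) x' x2 by auto
      qed
      then show ?thesis by simp
    next
      case 3
      have "y' \<noteq> 2 * n + 1"
      proof
        assume "y' = 2 * n + 1"
        then have "zeros_at n w' {x}" using zeros_atI_single[of n w' x'] x2 3 by (simp add: x'_def y'_def)
        then show False using zeros_at_unique[OF n assms(5,4) _ assms(1)] assms(6) by simp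
      qed
      then have y2: "y' \<le> 2 * n" using y' by simp
      have hy: "target n w y' \<noteq> target n w' y'"
        using zeros_at_differ'[OF assms(1), of y' w'] y' y2 3 by simp
      have hx: "target n w x \<noteq> target n w' x"
        using target_zero[of n w x] target_zero[of n w' x] x' x2 y2 first_zero_single[OF assms(1)] assms(2,3) 3
          first_zero(1)[of n w] by (simp add: y'_def)
      have l1: "target n w (n - 1) \<noteq> target n w' (n - 1)"
        using Pw[of "n - 1"] target_n_minus_1[of n w'] x2 y2 assms(2,3) by (simp add: x'_def y'_def)
      have low': "target n w i \<noteq> target n w' i" if "1 \<le> i" "i \<le> x - n - 1" for i
      proof -
        have "n + i < x" "i \<le> n" using that assms(2,3) by auto
        then show ?thesis using Pw[of i] before[of i] that 3 y2 by simp
      qed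
      \<comment> \<open>The second zero drops from \<open>2 * n + 1\<close> to \<open>y'\<close>.
        This changes the \<open>x - n - 1\<close> elements before the first zero and
        \<open>x\<close>; \<open>n - 1\<close> now points to \<open>n\<close>, and the digit at
        \<open>y'\<close> is flipped.\<close>
      have "x - n + 2 \<le> edge_mods n w w'"
      proof (rule edge_mods_ge[where S = "{1..x - n - 1} \<union> {n - 1, x, y'}"])
        show "card ({1..x - n - 1} \<union> {n - 1, x, y'}) = x - n + 2"
        proof -
          have "n - 1 \<noteq> x" "n - 1 \<noteq> y'" "x \<noteq> y'" "{1..x - n - 1} \<inter> {n - 1, x, y'} = {}"
            using 3 assms(2,3) y'(2) by auto
          then show ?thesis using assms(2) by (subst card_Un_disjoint) (auto simp: card_insert_if)
        qed
        show "1 \<le> i \<and> i \<le> 2 * n + 1 \<and> target n w i \<noteq> target n w' i" if "i \<in> {1..x - n - 1} \<union> {n - 1, x, y'}" for i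
          using that low'[of i] hx hy l1 3 assms(2,3) x' x2 y' y2 by auto
      qed
      then show ?thesis by simp
    qed
  qed
qed

text \<open>Here \<open>n - 1\<close> points to \<open>n\<close>, and it does so in every
  \<open>w'\<close> with two digits 0. It therefore drops out of the range counted for a single
  zero, and \<open>2 * n + 2 - x\<close> replaces \<open>2 * n + 3 - x\<close>. For
  \<open>x = 2 * n - 1\<close> this would be 3, too small for any competitor, so that case gets its
  own bound.\<close>

lemma lower_double:
  assumes "zeros_at n w {x, 2 * n}" "n + 1 < x" "x < 2 * n"
    and "w \<in> codec_range n" "w' \<in> codec_range n" "w' \<noteq> w"
  shows "(if x = 2 * n - 1 then 4 else min (x - n + 2) (2 * n + 2 - x)) \<le> edge_mods n w w'"
proof -
  define x' where "x' = first_zero n w'"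
  define y' where "y' = next_zero n w' x'"
  have n: "3 \<le> n" using assms(2,3) by simp
  then have n1: "1 \<le> n" by simp
  have x': "n + 1 < x'" "x' \<le> 2 * n + 1" "zero_at n w' x'"
    using first_zero_gt[OF n1 assms(5)] first_zero[of n w'] unfolding x'_def by auto
  have Pw: "target n w i = (if n + i < x then 2 * n else if i = n - 1 then n else x)"
    if "1 \<le> i" "i \<le> n" for i
    using target_double[OF assms(1) _ _ that] assms(2,3) by simp
  have hl: "target n w (2 * n) \<noteq> target n w' (2 * n)" if "\<not> zero_at n w' (2 * n)"
    using zeros_at_differ[OF assms(1), of "2 * n" w'] that n by simp
  have hx0: "target n w x \<noteq> target n w' x" if "\<not> zero_at n w' x"
    using zeros_at_differ[OF assms(1), of x w'] that assms(2,3) by simp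
  show ?thesis
  proof (cases "x' \<le> 2 * n")
    case False
    then have z: "zeros_at n w' {}" using zeros_atI_none[of n w'] x' by (simp add: x'_def)
    have low: "target n w i \<noteq> target n w' i" if "x - n \<le> i" "i \<le> n" for i
      using Pw[of i] target_none_low[OF z, of i] that assms(2,3) by auto
    have h: "target n w x \<noteq> target n w' x" "target n w (2 * n) \<noteq> target n w' (2 * n)"
      using hx0 hl z assms(2,3) n by (auto simp: zeros_at_def)
    have "2 * n + 3 - x \<le> edge_mods n w w'"
    proof (rule edge_mods_ge[where S = "{x - n..n} \<union> {x, 2 * n}"])
      show "card ({x - n..n} \<union> {x, 2 * n}) = 2 * n + 3 - x"
        using assms(2,3) by (subst card_Un_disjoint) auto
      show "1 \<le> i \<and> i \<le> 2 * n + 1 \<and> target n w i \<noteq> target n w' i" if "i \<in> {x - n..n} \<union> {x, 2 * n}" for i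
        using that low[of i] h assms(2,3) by auto
    qed
    then show ?thesis using assms(2,3) by auto
  next
    case x2: True
    note y' = next_zero[OF x2, of w', folded y'_def]
    have before: "target n w' i = y'" if "1 \<le> i" "n + i < x'" for i
      using target_before_first[of i n w'] that x2 by (simp add: x'_def y'_def)
    have after: "target n w' i = x' \<or> target n w' i \<le> n" if "i \<le> n" "x' \<le> n + i" for i
      using target_after_first[of i n w'] that by (simp add: x'_def)
    have low: "target n w i \<noteq> target n w' i" if "x' \<noteq> x" "x - n \<le> i" "i \<le> n" "i \<noteq> n - 1" for i
      using Pw[of i] before[of i] after[of i] that y' assms(2,3) by (cases "n + i < x'") auto
    have hx': "target n w x' \<noteq> target n w' x'" if "x' \<noteq> x" "x' \<noteq> 2 * n"
      using zeros_at_differ'[OF assms(1), of x' w'] that x' x2 by auto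
    consider "x < x'" | "x' < x" | "x' = x" by linarith
    then show ?thesis
    proof cases
      case 1
      have hx: "target n w x \<noteq> target n w' x"
        using hx0 first_zero(4)[of x n w'] 1 by (simp add: x'_def)
      have nl: "target n w (n - 1) \<noteq> target n w' (n - 1)" if "x' = 2 * n"
        using Pw[of "n - 1"] before[of "n - 1"] that y' 1 n by auto
      \<comment> \<open>If \<open>x' = 2 * n\<close>, the digit at \<open>x'\<close> is 0 in both
        words. But then \<open>w'\<close> has a single digit 0, and \<open>n - 1\<close> points to
        \<open>2 * n + 1\<close> instead of \<open>n\<close>.\<close>
      define j where "j = (if x' = 2 * n then n - 1 else x')"
      have j: "target n w j \<noteq> target n w' j" "j = n - 1 \<or> x < j \<and> j \<le> 2 * n"
        using nl hx' 1 x2 by (auto simp: j_def)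
      show ?thesis
      proof (cases "x = 2 * n - 1")
        case True
        then have "x' = 2 * n" using 1 x2 by simp
        moreover from this have "y' = 2 * n + 1" using y' by simp
        ultimately have d1: "target n w 1 \<noteq> target n w' 1"
          using Pw[of 1] before[of 1] True n by simp
        have dn: "target n w n \<noteq> target n w' n" using low[of n] 1 True n by simp
        have "distinct [1, n - 1, n, x]" "{1, n - 1, n, x} \<subseteq> {1..2 * n + 1}"
          using n assms(2,3) by auto
        then have "4 \<le> edge_mods n w w'"
          using d1 nl[OF \<open>x' = 2 * n\<close>] dn hx by (rule edge_mods_ge_4)
        then show ?thesis using True by simp
      next
        case False
        have "2 * n + 2 - x \<le> edge_mods n w w'"
        proof (rule edge_mods_ge[where S = "{x - n..n - 2} \<union> {n, x, j}"])
          show "card ({x - n..n - 2} \<union> {n, x, j}) = 2 * n + 2 - x"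
            using 1 assms(2,3) x' j(2) n False by (subst card_Un_disjoint) auto
          have low': "target n w i \<noteq> target n w' i" if "i \<in> {x - n..n - 2} \<union> {n}" for i
          proof (rule low)
            show "x' \<noteq> x" using 1 by simp
            show "x - n \<le> i" "i \<le> n" "i \<noteq> n - 1" using that n assms(3) by auto
          qed
          show "1 \<le> i \<and> i \<le> 2 * n + 1 \<and> target n w i \<noteq> target n w' i" if "i \<in> {x - n..n - 2} \<union> {n, x, j}" for i
            using that low'[of i] hx j assms(2,3) by auto
        qed
        then show ?thesis using False by simp
      qed
    next
      case 2
      have e: "1 \<le> x - n - 1" "x - n - 1 \<le> n" "n + (x - n - 1) < x" "x' \<le> n + (x - n - 1)"
        using 2 assms(2,3) x' by linarith+
      have l1: "target n w (x - n - 1) \<noteq> target n w' (x - n - 1)"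
        using Pw[OF e(1,2)] e(3) after[OF e(2,4)] 2 assms(2,3) by auto
      show ?thesis
      proof (cases "x = 2 * n - 1")
        case True
        \<comment> \<open>Either \<open>w'\<close> drops one of the two zeros of \<open>w\<close>,
          which flips a digit, or \<open>x\<close> is a zero behind \<open>x'\<close>. Then the
          second zero of \<open>w'\<close> is at most \<open>x\<close>, and 1 no longer points to
          \<open>2 * n\<close>.\<close>
        have "\<exists>j. (j = 1 \<and> x - n - 1 \<noteq> 1 \<or> j = x \<or> j = 2 * n) \<and> target n w j \<noteq> target n w' j"
        proof (cases "zero_at n w' x \<and> zero_at n w' (2 * n)")
          case False
          then show ?thesis using hx0 hl by blast
        next
          case zz: True
          then have "y' \<le> x" using next_zero(6)[OF x2, of x w'] 2 by (simp add: y'_def)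
          then have "target n w 1 \<noteq> target n w' 1"
            using Pw[of 1] before[of 1] x' 2 n assms(3) by simp
          moreover have "x - n - 1 \<noteq> 1" using 2 x'(1) by linarith
          ultimately show ?thesis by blast
        qed
        then obtain j where j: "j = 1 \<and> x - n - 1 \<noteq> 1 \<or> j = x \<or> j = 2 * n" "target n w j \<noteq> target n w' j"
          by blast
        have dn: "target n w n \<noteq> target n w' n" using low[of n] 2 True n by simp
        have dx': "target n w x' \<noteq> target n w' x'" using hx' 2 assms(3) by simp
        have "j \<notin> {x - n - 1, n, x'}" "1 \<le> j" "j \<le> 2 * n"
          using j(1) 2 x'(1) True n by auto
        moreover have "x - n - 1 < n" "n < x'" using 2 x'(1) assms(3) by auto
        ultimately have "distinct [x - n - 1, n, x', j]" "{x - n - 1, n, x', j} \<subseteq> {1..2 * n + 1}"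
          using e(1) x'(2) by auto
        then have "4 \<le> edge_mods n w w'" using l1 dn dx' j(2) by (rule edge_mods_ge_4)
        then show ?thesis using True by simp
      next
        case False
        have low': "target n w i \<noteq> target n w' i" if "i \<in> {x - n - 1..n - 2} \<union> {n}" for i
        proof (cases "i = x - n - 1")
          case False
          have "x' \<noteq> x" "x - n \<le> i" "i \<le> n" "i \<noteq> n - 1" using 2 False that n assms(2,3) by auto
          then show ?thesis by (rule low)
        qed (use l1 in simp)
        have "2 * n + 2 - x \<le> edge_mods n w w'"
        proof (rule edge_mods_ge[where S = "{x - n - 1..n - 2} \<union> {n, x'}"])
          show "card ({x - n - 1..n - 2} \<union> {n, x'}) = 2 * n + 2 - x"
            using 2 assms(2,3) x' n False by (subst card_Un_disjoint) auto
          show "1 \<le> i \<and> i \<le> 2 * n + 1 \<and> target n w i \<noteq> target n w' i" if "i \<in> {x - n - 1..n - 2} \<union> {n, x'}" for i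
            using that low'[of i] hx' 2 assms(3) e(1) x'(1) n by auto
        qed
        then show ?thesis using False by simp
      qed
    next
      case 3
      have yn: "y' \<noteq> 2 * n"
      proof
        assume "y' = 2 * n"
        then have "zeros_at n w' {x, 2 * n}"
          using zeros_atI_double[of n w' x'] assms(3) 3 by (simp add: x'_def y'_def)
        then show False using zeros_at_unique[OF n1 assms(5,4) _ assms(1)] assms(6) by simp
      qed
      have zx: "zero_at n w x" using assms(1-3) by (simp add: zeros_at_def)
      have hx: "target n w x \<noteq> target n w' x"
        using target_zero[OF zx] target_zero[OF x'(3) x2] first_zero_double[OF assms(1)] assms(2,3) 3 yn
        by (simp add: y'_def)
      have low': "target n w i \<noteq> target n w' i" if "1 \<le> i" "i \<le> x - n - 1" for i
      proof -
        have "n + i < x" "i \<le> n" using that assms(2,3) by auto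
        then show ?thesis using Pw[of i] before[of i] that 3 yn by simp
      qed
      \<comment> \<open>Two changes besides \<open>x\<close> and the elements before it. If no
        second digit 0 is left, they are at \<open>n - 1\<close> and \<open>2 * n\<close>. Otherwise
        \<open>k\<close> is the new zero \<open>y'\<close>, and \<open>j\<close> is
        \<open>2 * n\<close> if the last digit is flipped; if it is still 0, then \<open>w'\<close>
        has at least three digits 0 and \<open>n - 2\<close> points to \<open>n - 1\<close>.\<close>
      have "\<exists>j k. (j = n - 1 \<and> k = 2 * n \<or> x < k \<and> k < 2 * n \<and> (j = 2 * n \<or> j = n - 2 \<and> x \<noteq> 2 * n - 1)) \<and>
          target n w j \<noteq> target n w' j \<and> target n w k \<noteq> target n w' k"
      proof (cases "y' \<le> 2 * n")
        case False
        then have "y' = 2 * n + 1" using y' by simp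
        then have s: "zeros_at n w' {x}" using zeros_atI_single[of n w' x'] x2 3 by (simp add: x'_def y'_def)
        have "target n w (n - 1) \<noteq> target n w' (n - 1)"
          using Pw[of "n - 1"] target_single[OF s, of "n - 1"] assms(2,3) n by auto
        moreover have "target n w (2 * n) \<noteq> target n w' (2 * n)" using hl s assms(3) n by (simp add: zeros_at_def)
        ultimately show ?thesis by (intro exI[of _ "n - 1"] exI[of _ "2 * n"]) simp
      next
        case True
        then have y2: "y' < 2 * n" using yn by simp
        have hy: "target n w y' \<noteq> target n w' y'"
          using zeros_at_differ'[OF assms(1), of y' w'] y' y2 3 by simp
        show ?thesis
        proof (cases "zero_at n w' (2 * n)")
          case False
          then show ?thesis using hl hy y'(2) y2 3 by (intro exI[of _ "2 * n"] exI[of _ y']) simp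
        next
          case zl: True
          then have "next_zero n w' y' \<le> 2 * n" using next_zero(6)[OF True, of "2 * n" w'] y2 by simp
          then have "target n w' (n - 2) = n - 1" using target_n_minus_2[of n w'] x2 y2 by (simp add: x'_def y'_def)
          moreover have "x \<noteq> 2 * n - 1" using y' y2 3 by auto
          ultimately have "target n w (n - 2) \<noteq> target n w' (n - 2)" 
            using Pw[of "n - 2"] assms(2,3) n by auto
          then show ?thesis using hy y'(2) y2 3 \<open>x \<noteq> 2 * n - 1\<close>
            by (intro exI[of _ "n - 2"] exI[of _ y']) simp
        qed
      qed
      then obtain j k where jk: "j = n - 1 \<and> k = 2 * n \<or>
          x < k \<and> k < 2 * n \<and> (j = 2 * n \<or> j = n - 2 \<and> x \<noteq> 2 * n - 1)"
        "target n w j \<noteq> target n w' j" "target n w k \<noteq> target n w' k" by blast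
      have "x - n + 2 \<le> edge_mods n w w'"
      proof (rule edge_mods_ge[where S = "{1..x - n - 1} \<union> {x, j, k}"])
        have "j \<notin> {1..x - n - 1} \<and> k \<notin> {1..x - n - 1} \<and> x \<notin> {1..x - n - 1} \<and> x \<noteq> j \<and> x \<noteq> k \<and> j \<noteq> k"
          using jk(1) assms(2,3) n unfolding atLeastAtMost_iff by linarith
        then show "card ({1..x - n - 1} \<union> {x, j, k}) = x - n + 2"
          using assms(2) by (subst card_Un_disjoint) (auto simp: card_insert_if)
        have "1 \<le> j" "j \<le> 2 * n + 1" "1 \<le> k" "k \<le> 2 * n + 1"
          using jk(1) assms(2,3) n by linarith+
        then show "1 \<le> i \<and> i \<le> 2 * n + 1 \<and> target n w i \<noteq> target n w' i" if "i \<in> {1..x - n - 1} \<union> {x, j, k}" for i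
          using that low'[of i] hx jk(2,3) assms(2,3) by auto
      qed
      then show ?thesis using assms(2,3) by auto
    qed
  qed
qed

section \<open>Numbers with two internal zeros\<close>

lemma edge_mods_ge_3:
  assumes "distinct [a, b, c]" "{a, b, c} \<subseteq> {1..2 * n + 1}"
    and "target n w a \<noteq> target n w' a" "target n w b \<noteq> target n w' b" "target n w c \<noteq> target n w' c"
  shows "3 \<le> edge_mods n w w'"
proof (rule edge_mods_ge[where S = "{a, b, c}"])
  show "card {a, b, c} = 3" using distinct_card[OF assms(1)] by simp
  show "1 \<le> i \<and> i \<le> 2 * n + 1 \<and> target n w i \<noteq> target n w' i" if "i \<in> {a, b, c}" for i
  proof (intro conjI)
    show "1 \<le> i" "i \<le> 2 * n + 1" using that assms(2) by auto
    show "target n w i \<noteq> target n w' i" using that assms(3-5) by blast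
  qed
qed

lemma below_cong:
  assumes "\<And>u. n < u \<Longrightarrow> u < v \<Longrightarrow> zero_at n w u \<longleftrightarrow> zero_at n w' u" "v \<le> 2 * n + 1"
  shows "zeros_below n w v = zeros_below n w' v" "ones_below n w v = ones_below n w' v"
proof -
  have "zero_at n w u \<longleftrightarrow> zero_at n w' u" "one_at n w u \<longleftrightarrow> one_at n w' u" if "u < v" for u
    using assms(1)[of u] assms(2) that by (auto simp: zero_at_def one_at_def)
  then show "zeros_below n w v = zeros_below n w' v" "ones_below n w v = ones_below n w' v"
    by (auto simp: zeros_below_def ones_below_def intro!: arg_cong[where f = card])
qed

text \<open>At the first digit in which the numbers differ, the index that encodes the digit 1 of \<open>w\<close>
  belongs in \<open>w'\<close> to a later position with more zeros below it.\<close>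

lemma target_first_difference:
  assumes t: "one_at n w t" "zero_at n w' t" "2 \<le> zeros_below n w t"
    and agree: "\<And>u. n < u \<Longrightarrow> u < t \<Longrightarrow> zero_at n w u \<longleftrightarrow> zero_at n w' u"
  shows "target n w (Suc (ones_below n w t)) \<noteq> target n w' (Suc (ones_below n w t))"
proof -
  let ?i = "Suc (ones_below n w t)" and ?z = "zeros_below n w t"
  let ?y = "sip_fun n w' ?i"
  have tb: "n < t" "t \<le> 2 * n" using one_at_bounds[OF t(1)] by auto
  have i: "1 \<le> ?i" "?i \<le> n" using sip_fun_one[OF t(1)] by auto
  have same: "zeros_below n w' t = ?z" "ones_below n w' t = ones_below n w t"
    using below_cong[of n t w w'] agree tb by auto
  have sum: "ones_below n w t + ?z = t - Suc n" using below_add[of n t w] tb by simp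
  have more: "?z < zeros_below n w' ?y"
    using i
  proof (cases rule: sip_fun_cases[where w = w'])
    case one_at
    then have "ones_below n w' ?y = ones_below n w' t" using same by simp
    then have "\<not> ?y < t" using ones_below_less[OF one_at(1), of t] by auto
    moreover have "?y \<noteq> t" using one_at(1) t(2) one_at_not_zero_at by metis
    ultimately have "t < ?y" by simp
    then show ?thesis using zeros_below_less[OF t(2)] same by metis
  next
    case zero_at
    then show ?thesis using sum tb by linarith
  qed
  have "first_zero n w' \<le> n + ?i"
  proof (rule ccontr)
    assume "\<not> ?thesis"
    then have "?y = n + ?i" "n + ?i < first_zero n w'" using sip_fun_before_first[of ?i n w'] by auto
    then have "zeros_below n w' ?y = 0"
      using zeros_below_mono[of ?y "first_zero n w'" n w'] zeros_below_first[of n w'] by simp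
    then show False using more by simp
  qed
  note q = target_zeros_below[OF i(2) this]
  have "target n w' ?i = n + 2 - zeros_below n w' ?y" using q(1) more t(3) by simp
  moreover have "target n w ?i = n + 2 - ?z" by (rule target_index_one[OF t(1,3)])
  ultimately show ?thesis using more q(3) by simp
qed

lemma lower_three:
  assumes "1 \<le> n" "first_zero n w < 2 * n" "next_zero n w (first_zero n w) < 2 * n"
    and "w \<in> codec_range n" "w' \<in> codec_range n" "w' \<noteq> w"
  shows "3 \<le> edge_mods n w w'"
proof -
  define x where "x = first_zero n w"
  define y where "y = next_zero n w x"
  define x' where "x' = first_zero n w'"
  define y' where "y' = next_zero n w' x'"
  have x: "n + 1 < x" "x < 2 * n" "zero_at n w x" "\<And>u. u < x \<Longrightarrow> \<not> zero_at n w u"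
    using first_zero_gt[OF assms(1,4)] first_zero(1)[of n w] first_zero(4)[of _ n w] assms(2)
    unfolding x_def by auto
  have y: "x < y" "y < 2 * n" "zero_at n w y" "\<And>u. x < u \<Longrightarrow> u < y \<Longrightarrow> \<not> zero_at n w u"
    using next_zero(1,2)[of x n w] next_zero(5)[of x n _ w] assms(3) x(2) unfolding y_def x_def by auto
  have x': "n + 1 < x'" "x' \<le> 2 * n + 1" "zero_at n w' x'" "\<And>u. u < x' \<Longrightarrow> \<not> zero_at n w' u"
    using first_zero_gt[OF assms(1,5)] first_zero(1,3)[of n w'] first_zero(4)[of _ n w']
    unfolding x'_def by auto
  have Pn: "target n w n = x" and P1: "target n w 1 = y"
    using target_n[of n w] target_before_first[of 1 n w] x(1,2) by (auto simp: x_def y_def)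
  show ?thesis
  proof (cases "x' \<le> 2 * n")
    case False
    then have z: "zeros_at n w' {}" using zeros_atI_none[of n w'] x'(2) by (simp add: x'_def)
    have "target n w n \<noteq> target n w' n" using target_none_low[OF z, of n] Pn x(2) assms(1) by simp
    moreover have "target n w x \<noteq> target n w' x" "target n w y \<noteq> target n w' y"
      using target_differ[of n _ w w'] z x(1-3) y(1-3) by (auto simp: zeros_at_def)
    moreover have "distinct [n, x, y]" "{n, x, y} \<subseteq> {1..2 * n + 1}" using x(1,2) y(1,2) by auto
    ultimately show ?thesis by (intro edge_mods_ge_3)
  next
    case True
    have y': "x' < y'" "y' \<le> 2 * n + 1" "zero_at n w' y'" "\<And>u. x' < u \<Longrightarrow> u < y' \<Longrightarrow> \<not> zero_at n w' u"
      using next_zero(1-3)[OF True, of w'] next_zero(5)[OF True, of _ w'] unfolding y'_def by auto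
    have Pn': "target n w' n = x'" and P1': "target n w' 1 = y'"
      using target_n[of n w'] target_before_first[of 1 n w'] x'(1) True by (auto simp: x'_def y'_def)
    show ?thesis
    proof (cases "x = x'")
      case False
      have hn: "target n w n \<noteq> target n w' n" using Pn Pn' False by simp
      show ?thesis
      proof (cases "y = y'")
        case True
        \<comment> \<open>Say \<open>x < x'\<close>. Then \<open>x\<close> precedes all zeros of
          \<open>w'\<close>, and \<open>x'\<close> lies strictly between the first two zeros of
          \<open>w\<close>; the other case is symmetric. So both digits are flipped.\<close>
        have "\<not> zero_at n w' x" "\<not> zero_at n w x'"
          using x(4)[of x'] x'(4)[of x] y(4)[of x'] y'(4)[of x] y(1) y'(1) True False
          by (cases x x' rule: linorder_cases; simp)+
        then have "target n w x \<noteq> target n w' x" "target n w x' \<noteq> target n w' x'"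
          using target_differ[of n x w w'] target_differ[of n x' w w'] x(1-3) x'(1-3) \<open>x' \<le> 2 * n\<close> by auto
        moreover have "distinct [n, x, x']" "{n, x, x'} \<subseteq> {1..2 * n + 1}"
          using x(1,2) x'(1,2) False by auto
        ultimately show ?thesis using hn by (intro edge_mods_ge_3)
      next
        case ne: False
        define v where "v = min x x'"
        have v: "n + 1 < v" "v \<le> 2 * n" using x(1,2) x'(1) by (auto simp: v_def)
        have "zero_at n w v \<noteq> zero_at n w' v"
          using x(3) x(4)[of x'] x'(3) x'(4)[of x] False by (cases x x' rule: linorder_cases) (auto simp: v_def)
        then have "target n w v \<noteq> target n w' v" using target_differ[of n v w w'] v by simp
        moreover have "target n w 1 \<noteq> target n w' 1" using P1 P1' ne by simp
        moreover have "distinct [1, n, v]" "{1, n, v} \<subseteq> {1..2 * n + 1}" using v x(1,2) by auto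
        ultimately show ?thesis using hn by (intro edge_mods_ge_3)
      qed
    next
      case xx: True
      show ?thesis
      proof (cases "y = y'")
        case False
        define v where "v = min y y'"
        have v: "x < v" "v \<le> 2 * n" using y(1,2) y'(1) xx by (auto simp: v_def)
        have "zero_at n w v \<noteq> zero_at n w' v"
          using y(3) y(4)[of y'] y'(3) y'(4)[of y] y(1) y'(1) xx False
          by (cases y y' rule: linorder_cases) (auto simp: v_def)
        then have "target n w v \<noteq> target n w' v" using target_differ[of n v w w'] v x(1) by simp
        moreover have "target n w 1 \<noteq> target n w' 1" using P1 P1' False by simp
        moreover have "target n w x \<noteq> target n w' x"
          using target_zero[OF x(3)] target_zero[OF x'(3)] x(2) xx False by (simp add: y_def y'_def)
        moreover have "distinct [1, x, v]" "{1, x, v} \<subseteq> {1..2 * n + 1}" using v x(1,2) by auto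
        ultimately show ?thesis by (intro edge_mods_ge_3)
      next
        case yy: True
        \<comment> \<open>With both leading zeros equal, 1 and \<open>n\<close> give nothing. The
          three changes are at the first differing digit \<open>t\<close>, at the last zero
          \<open>p\<close> before it, whose next zero differs, and at the small element exchanged
          with \<open>t\<close> in the word that has a 1 there.\<close>
        have "\<exists>t. n < t \<and> t \<le> 2 * n \<and> zero_at n w t \<noteq> zero_at n w' t"
          using zero_at_eq_unique[OF assms(1,4,5)] assms(6) by blast
        define t where "t = (LEAST t. n < t \<and> t \<le> 2 * n \<and> zero_at n w t \<noteq> zero_at n w' t)"
        have t: "n < t" "t \<le> 2 * n" "zero_at n w t \<noteq> zero_at n w' t"
          using LeastI_ex[OF \<open>\<exists>t. _ t\<close>] unfolding t_def by auto
        have agree: "zero_at n w u \<longleftrightarrow> zero_at n w' u" if "n < u" "u < t" for u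
          using not_less_Least[of u "\<lambda>t. n < t \<and> t \<le> 2 * n \<and> zero_at n w t \<noteq> zero_at n w' t"] that t(2)
          unfolding t_def by auto
        have yt: "y < t"
        proof (rule ccontr)
          assume "\<not> ?thesis"
          then consider "t < x" | "t = x" | "x < t" "t < y" | "t = y" by linarith
          then show False
            by cases (use t(3) x(3,4) x'(3,4) y(3,4) y'(3,4) xx yy in blast)+
        qed
        have lt: "first_zero n w < t" "t \<le> 2 * n + 1" using yt y(1) t(2) by (auto simp: x_def)
        obtain p where p: "zero_at n w p" "p < t" "\<And>u. p < u \<Longrightarrow> u < t \<Longrightarrow> \<not> zero_at n w u" "p \<le> 2 * n"
          using prev_zero[OF lt] by blast
        have pn: "n < p" using zero_at_bounds[OF p(1)] by simp
        have p': "zero_at n w' p" "\<And>u. p < u \<Longrightarrow> u < t \<Longrightarrow> \<not> zero_at n w' u"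
          using agree p(1-3) pn by auto
        have "next_zero n w p \<noteq> next_zero n w' p"
        proof (cases "zero_at n w t")
          case True
          then have "next_zero n w p = t" using p by (intro next_zero_eqI) auto
          then show ?thesis using next_zero(1)[OF p(4), of w'] t(3) True by auto
        next
          case False
          then have "next_zero n w' p = t" using t(3) p(2) p' by (intro next_zero_eqI) auto
          then show ?thesis using next_zero(1)[OF p(4), of w] False by auto
        qed
        then have hp: "target n w p \<noteq> target n w' p" using target_zero[OF p(1,4)] target_zero[OF p'(1) p(4)] by simp
        have ht: "target n w t \<noteq> target n w' t" using target_differ[OF t] .
        have z2: "2 \<le> zeros_below n w t"
          using zeros_below_less[OF x(3) y(1)] zeros_below_less[OF y(3) yt] by linarith
        have same: "zeros_below n w t = zeros_below n w' t" "ones_below n w t = ones_below n w' t"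
          using below_cong[of n t w w'] agree t(2) by auto
        define i where "i = Suc (ones_below n w t)"
        have hi: "target n w i \<noteq> target n w' i \<and> i \<le> n"
        proof (cases "zero_at n w t")
          case False
          then have o: "one_at n w t" "zero_at n w' t" using one_at_or_zero_at[of n t w] t by auto
          show ?thesis
            using target_first_difference[OF o z2 agree] sip_fun_one(2)[OF o(1)] by (simp add: i_def)
        next
          case True
          then have o: "one_at n w' t" using one_at_or_zero_at[of n t w'] t by auto
          show ?thesis
            using target_first_difference[OF o True] z2 same agree sip_fun_one(2)[OF o] by (auto simp: i_def)
        qed
        have "distinct [i, p, t]" "{i, p, t} \<subseteq> {1..2 * n + 1}"
          using hi t(1,2) p(2) pn by (auto simp: i_def)
        then show ?thesis using conjunct1[OF hi] hp ht by (rule edge_mods_ge_3)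
      qed
    qed
  qed
qed

text \<open>The last digit does not enter the ranks of earlier positions, so an earlier one keeps
  its partner.\<close>

lemma sip_fun_one_flip:
  assumes agree: "\<And>v. n < v \<Longrightarrow> v < 2 * n \<Longrightarrow> zero_at n w v \<longleftrightarrow> zero_at n w' v"
    and i: "1 \<le> i" "i \<le> n" "one_at n w (sip_fun n w i)" "sip_fun n w i < 2 * n"
  shows "sip_fun n w' i = sip_fun n w i"
    "zeros_below n w' (sip_fun n w i) = zeros_below n w (sip_fun n w i)"
proof -
  let ?y = "sip_fun n w i"
  have y: "n < ?y" using one_at_bounds[OF i(3)] by simp
  have same: "zeros_below n w ?y = zeros_below n w' ?y" "ones_below n w ?y = ones_below n w' ?y"
    using below_cong[of n ?y w w'] agree i(4) by auto
  then show "zeros_below n w' ?y = zeros_below n w ?y" by simp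
  have o': "one_at n w' ?y"
    using agree[OF y i(4)] one_at_not_zero_at[OF i(3)] one_at_or_zero_at[of n ?y w'] y i(4) by auto
  have "sip_fun n w ?y = i" using sip_fun_invol[of i n w] i(1,2) by simp
  then have "sip_fun n w' ?y = i" using sip_fun_one(1)[OF i(3)] sip_fun_one(1)[OF o'] same by simp
  then show "sip_fun n w' i = ?y" using sip_fun_invol[of ?y n w'] y i(4) by simp
qed

text \<open>Only three edges can change: at \<open>2 * n\<close>, at the last zero \<open>p\<close>
  before it, whose next zero becomes \<open>2 * n + 1\<close>, and at \<open>?m\<close>, the partner
  of \<open>2 * n\<close> in \<open>w'\<close>. The two zeros before \<open>2 * n\<close> keep the
  targets of the elements preceding the first zero.\<close>

lemma flip_last_le:
  assumes "1 \<le> n" "first_zero n w < 2 * n" "next_zero n w (first_zero n w) < 2 * n"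
    and agree: "\<And>v. n < v \<Longrightarrow> v < 2 * n \<Longrightarrow> zero_at n w v \<longleftrightarrow> zero_at n w' v"
    and last: "zero_at n w (2 * n)" "\<not> zero_at n w' (2 * n)"
  shows "edge_mods n w w' \<le> 3"
proof -
  define x where "x = first_zero n w"
  define y where "y = next_zero n w x"
  have x: "n < x" "x < 2 * n" "zero_at n w x" "\<And>u. u < x \<Longrightarrow> \<not> zero_at n w u"
    using first_zero(1,2)[of n w] first_zero(4)[of _ n w] assms(2) unfolding x_def by auto
  have y: "x < y" "y < 2 * n" "zero_at n w y" "\<And>u. x < u \<Longrightarrow> u < y \<Longrightarrow> \<not> zero_at n w u"
    using next_zero(1,2)[of x n w] next_zero(5)[of x n _ w] assms(3) x(2) unfolding y_def x_def by auto
  have x': "first_zero n w' = x"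
  proof (rule first_zero_eqI)
    show "zero_at n w' x" using agree[of x] x(1-3) by simp
    show "\<not> zero_at n w' v" if "n < v" "v < x" for v using agree[of v] x(4)[of v] that x(2) by simp
  qed
  have y': "next_zero n w' x = y"
  proof (rule next_zero_eqI)
    show "zero_at n w' y" "x < y" using agree[of y] x(1) y(1-3) by simp_all
    show "\<not> zero_at n w' v" if "x < v" "v < y" for v using agree[of v] y(4)[of v] that x(1) y(2) by simp
  qed
  obtain p where p: "zero_at n w p" "p < 2 * n" "\<And>u. p < u \<Longrightarrow> u < 2 * n \<Longrightarrow> \<not> zero_at n w u"
    using prev_zero[of n w "2 * n", OF assms(2)] by (metis le_add1)
  let ?m = "Suc (ones_below n w (2 * n))"
  have same: "ones_below n w (2 * n) = ones_below n w' (2 * n)"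
    by (rule below_cong(2)) (use agree in auto)
  have one_at': "one_at n w' (2 * n)" using last(2) one_at_or_zero_at[of n "2 * n" w'] assms(1) by simp
  show ?thesis
  proof (rule edge_mods_le[where S = "{p, 2 * n, ?m}"])
    fix i assume i: "1 \<le> i" "i \<le> 2 * n" "i \<notin> {p, 2 * n, ?m}"
    have i_ne: "i \<noteq> p" "i \<noteq> 2 * n" "i \<noteq> ?m" using i(3) by auto
    have i_lt: "i < 2 * n" using i(2) i_ne(2) by (rule le_neq_implies_less)
    show "target n w i = target n w' i"
    proof (cases "n < i")
      case True
      show ?thesis
      proof (cases "zero_at n w i")
        case z: False
        then show ?thesis using target_same[OF True i(2)] agree[OF True i_lt] by blast
      next
        case z: True
        have ip: "i < p" 
        proof (rule ccontr)
          assume "\<not> i < p"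
          then have "p < i" using i_ne(1) by linarith
          then show False using p(3) z i_lt by blast
        qed
        define q where "q = next_zero n w i"
        have q: "i < q" "zero_at n w q" "\<And>u. i < u \<Longrightarrow> u < q \<Longrightarrow> \<not> zero_at n w u" "q \<le> p"
          using next_zero(1,2)[OF i(2), of w] next_zero(5)[OF i(2), of _ w] next_zero(6)[OF i(2) ip p(1)]
          unfolding q_def by auto
        have "next_zero n w' i = q"
        proof (rule next_zero_eqI)
          show "zero_at n w' q" "i < q" using agree[of q] q(1,2,4) p(2) True by simp_all
          show "\<not> zero_at n w' v" if "i < v" "v < q" for v
            using agree[of v] q(3)[OF that] that q(4) p(2) True by simp
        qed
        moreover have "zero_at n w' i" using agree[OF True i_lt] z by blast
        ultimately show ?thesis using target_zero[OF z i(2)] target_zero[of n w' i] i(2) by (simp add: q_def)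
      qed
    next
      case False
      then have il: "i \<le> n" by simp
      show ?thesis
      proof (cases "n + i < x")
        case True
        then show ?thesis
          using target_before_first[OF i(1), of n w] target_before_first[OF i(1), of n w'] x' y' x(2)
          by (simp add: x_def y_def)
      next
        case nf: False
        let ?s = "sip_fun n w i" and ?s' = "sip_fun n w' i"
        \<comment> \<open>If either word exchanges \<open>i\<close> with a one before the last
          digit, so does the other. If both exchange it with a zero, the count is
          \<open>n + 1 - i\<close> in each. A one at \<open>2 * n\<close> occurs only in
          \<open>w'\<close>, for \<open>?m\<close>.\<close>
        have "zeros_below n w ?s = zeros_below n w' ?s'"
          using i(1) il
        proof (cases rule: sip_fun_cases[where w = w])
          case one_at
          have "?s \<noteq> 2 * n" using one_at(1) last(1) one_at_not_zero_at by metis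
          then have "?s < 2 * n" using one_at_bounds[OF one_at(1)] by simp
          then show ?thesis using sip_fun_one_flip[OF agree i(1) il one_at(1)] by simp
        next
          case zero_at
          note z = this
          from i(1) il show ?thesis
          proof (cases rule: sip_fun_cases[where w = w'])
            case one_at
            have "?s' \<noteq> 2 * n"
            proof
              assume "?s' = 2 * n"
              then have "i = ?m" using one_at(2) same by simp
              then show False using i_ne(3) by blast
            qed
            then have "?s' < 2 * n" using one_at_bounds[OF one_at(1)] by simp
            then have "?s = ?s'"
              by (intro sip_fun_one_flip(1)[of n w' w i]) (use i(1) il one_at(1) in \<open>simp_all add: agree\<close>)
            moreover have "\<not> zero_at n w ?s'"
              using agree[of ?s'] one_at_bounds[OF one_at(1)] one_at_not_zero_at[OF one_at(1)] \<open>?s' < 2 * n\<close> by simp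
            ultimately show ?thesis using z(1) by simp
          next
            case zero_at
            then show ?thesis using z(2-4) by linarith
          qed
        qed
        then show ?thesis
          using target_zeros_below(1)[OF il, of w] target_zeros_below(1)[OF il, of w'] nf x'
          by (simp add: x_def)
      qed
    qed
  next
    show "card {p, 2 * n, ?m} \<le> 3" by (simp add: card_insert_if)
  qed simp
qed

section \<open>Upper bounds and the minimum\<close>

lemma none_le:
  assumes "3 \<le> n" "zeros_at n w {}" "zeros_at n w' {2 * n - 1, 2 * n}"
  shows "edge_mods n w w' \<le> 4"
proof (rule edge_mods_le[where S = "{n - 1, n, 2 * n - 1, 2 * n}"])
  show "target n w i = target n w' i"
    if "1 \<le> i" "i \<le> 2 * n" "i \<notin> {n - 1, n, 2 * n - 1, 2 * n}" for i
  proof (cases "i \<le> n")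
    case True
    then show ?thesis using target_none_low[OF assms(2), of i] target_double[OF assms(3), of i] that assms(1) by auto
  next
    case False
    then show ?thesis using zeros_at_same[OF assms(2,3), of i] that by simp
  qed
qed (simp_all add: card_insert_if)

lemma single_shift_le:
  assumes "zeros_at n w {x}" "zeros_at n w' {x + 1}" "n < x" "x < 2 * n"
  shows "edge_mods n w w' \<le> 2 * n + 3 - x"
proof (rule edge_mods_le[where S = "{x - n..n} \<union> {x, x + 1}"])
  show "target n w i = target n w' i"
    if "1 \<le> i" "i \<le> 2 * n" "i \<notin> {x - n..n} \<union> {x, x + 1}" for i
  proof (cases "i \<le> n")
    case True
    then show ?thesis using target_single[OF assms(1), of i] target_single[OF assms(2), of i] that assms(3,4) by auto
  next
    case False
    then show ?thesis using zeros_at_same[OF assms(1,2), of i] that by simp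
  qed
  show "card ({x - n..n} \<union> {x, x + 1}) \<le> 2 * n + 3 - x"
    using assms(3,4) by (subst card_Un_disjoint) auto
qed simp

text \<open>The shifted zero must stay short of \<open>2 * n\<close> so that two digits remain 0.
  Then \<open>n - 1\<close> points to \<open>n\<close> in both words, whence the gap in the set of
  changes.\<close>

lemma double_shift_le:
  assumes "zeros_at n w {x, 2 * n}" "zeros_at n w' {x + 1, 2 * n}" "n < x" "x + 1 < 2 * n"
  shows "edge_mods n w w' \<le> 2 * n + 2 - x"
proof (rule edge_mods_le[where S = "{x - n..n - 2} \<union> {n, x, x + 1}"])
  show "target n w i = target n w' i"
    if "1 \<le> i" "i \<le> 2 * n" "i \<notin> {x - n..n - 2} \<union> {n, x, x + 1}" for i
  proof (cases "i \<le> n")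
    case True
    then show ?thesis using target_double[OF assms(1), of i] target_double[OF assms(2), of i] that assms(3,4) by auto
  next
    case False
    show ?thesis
    proof (cases "i = 2 * n")
      case True
      then show ?thesis using first_zero_double(3)[OF assms(1)] first_zero_double(3)[OF assms(2)] assms
          target_zero[of n w "2 * n"] target_zero[of n w' "2 * n"] by (simp add: zeros_at_def)
    next
      case False
      then show ?thesis using zeros_at_same[OF assms(1,2), of i] that \<open>\<not> i \<le> n\<close> by simp
    qed
  qed
  show "card ({x - n..n - 2} \<union> {n, x, x + 1}) \<le> 2 * n + 2 - x"
    using assms(3,4) by (subst card_Un_disjoint) auto
qed simp

text \<open>The second zero moves from \<open>2 * n + 1\<close> to \<open>2 * n\<close>, which is
  felt by \<open>x\<close> and the elements before it, and \<open>n - 1\<close> is redirected to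
  \<open>n\<close>. By symmetry the bound serves both for adding and for removing the final
  zero.\<close>

lemma single_double_le:
  assumes "zeros_at n w {x}" "zeros_at n w' {x, 2 * n}" "n < x" "x < 2 * n"
  shows "edge_mods n w w' \<le> x - n + 2"
proof (rule edge_mods_le[where S = "{1..x - n - 1} \<union> {n - 1, x, 2 * n}"])
  show "target n w i = target n w' i"
    if "1 \<le> i" "i \<le> 2 * n" "i \<notin> {1..x - n - 1} \<union> {n - 1, x, 2 * n}" for i
  proof (cases "i \<le> n")
    case True
    then show ?thesis using target_single[OF assms(1), of i] target_double[OF assms(2), of i] that assms(3,4) by auto
  next
    case False
    then show ?thesis using zeros_at_same[OF assms(1,2), of i] that by simp
  qed
  have "card ({1..x - n - 1} \<union> {n - 1, x, 2 * n}) \<le> card {1..x - n - 1} + card {n - 1, x, 2 * n}"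
    by (rule card_Un_le)
  also have "\<dots> \<le> x - n - 1 + 3" by (simp add: card_insert_if)
  finally show "card ({1..x - n - 1} \<union> {n - 1, x, 2 * n}) \<le> x - n + 2" using assms(3) by simp
qed simp

section \<open>The minimum for each configuration of zeros\<close>

lemma minVM_none:
  assumes "4 \<le> n" "w \<in> codec_range n" "zeros_at n w {}"
  shows "minVM n w = 4"
proof -
  obtain w' where w': "w' \<in> codec_range n" "zeros_at n w' {2 * n - 1, 2 * n}"
  proof -
    have "{2 * n - 1, 2 * n} \<subseteq> {n + 2..}" using assms(1) by auto
    then show ?thesis using zeros_at_exists[of n "{2 * n - 1, 2 * n}"] that assms(1) by auto
  qed
  have "zero_at n w' (2 * n) \<noteq> zero_at n w (2 * n)" using w'(2) assms(1,3) by (simp add: zeros_at_def)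
  then have "w' \<noteq> w" by auto
  then show ?thesis
    using minVM_eqI[OF w'(1)] none_le[OF _ assms(3) w'(2)] lower_none[OF assms(1,3,2)] assms(1) by simp
qed

lemma minVM_last:
  assumes "4 \<le> n" "w \<in> codec_range n" "zeros_at n w {2 * n}"
  shows "minVM n w = 4"
proof -
  obtain w' where w': "w' \<in> codec_range n" "zeros_at n w' {2 * n - 1}"
  proof -
    have "{2 * n - 1} \<subseteq> {n + 2..}" using assms(1) by auto
    then show ?thesis using zeros_at_exists[of n "{2 * n - 1}"] that assms(1) by auto
  qed
  have "zero_at n w' (2 * n) \<noteq> zero_at n w (2 * n)" using w'(2) assms(1,3) by (simp add: zeros_at_def)
  then have "w' \<noteq> w" by auto
  moreover have "edge_mods n w w' \<le> 4"
    using single_shift_le[OF w'(2), of w] assms(1,3) edge_mods_commute[of n w w'] by simp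
  ultimately show ?thesis
    using minVM_eqI[OF w'(1)] lower_last[OF assms(1,3,2)] by simp
qed

lemma minVM_single:
  assumes "w \<in> codec_range n" "zeros_at n w {x}" "n + 1 < x" "x < 2 * n"
  shows "minVM n w = min (x - n + 2) (2 * n + 3 - x)"
proof -
  have n: "1 \<le> n" using assms(3,4) by simp
  \<comment> \<open>The two competitors, one for each term of the minimum: \<open>w1\<close> gains a
    final zero, \<open>w2\<close> has the internal zero one place further right.\<close>
  obtain w1 where w1: "w1 \<in> codec_range n" "zeros_at n w1 {x, 2 * n}"
    using zeros_at_exists[of n "{x, 2 * n}"] assms(3,4) n by auto
  obtain w2 where w2: "w2 \<in> codec_range n" "zeros_at n w2 {x + 1}"
    using zeros_at_exists[of n "{x + 1}"] assms(3,4) n by auto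
  have "zero_at n w1 (2 * n) \<noteq> zero_at n w (2 * n)" using w1(2) assms by (simp add: zeros_at_def)
  then have ne1: "w1 \<noteq> w" by auto
  have "zero_at n w2 x \<noteq> zero_at n w x" using w2(2) assms by (simp add: zeros_at_def)
  then have ne2: "w2 \<noteq> w" by auto
  have le: "edge_mods n w w1 \<le> x - n + 2" "edge_mods n w w2 \<le> 2 * n + 3 - x"
    using single_double_le[OF assms(2) w1(2)] single_shift_le[OF assms(2) w2(2)] assms(3,4) by auto
  note lo = lower_single[OF assms(2-4,1)]
  show ?thesis
  proof (cases "x - n + 2 \<le> 2 * n + 3 - x")
    case True
    then show ?thesis using le(1) by (intro minVM_eqI[OF w1(1) ne1] lo) auto
  next
    case False
    then show ?thesis using le(2) by (intro minVM_eqI[OF w2(1) ne2] lo) auto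
  qed
qed

lemma minVM_double:
  assumes "w \<in> codec_range n" "zeros_at n w {x, 2 * n}" "n + 1 < x" "x < 2 * n"
  shows "minVM n w = (if x = 2 * n - 1 then 4 else min (x - n + 2) (2 * n + 2 - x))"
proof -
  have n: "3 \<le> n" using assms(3,4) by simp
  obtain w1 where w1: "w1 \<in> codec_range n" "zeros_at n w1 {x}"
    using zeros_at_exists[of n "{x}"] assms(3,4) n by auto
  have "zero_at n w1 (2 * n) \<noteq> zero_at n w (2 * n)" using w1(2) assms by (simp add: zeros_at_def)
  then have ne1: "w1 \<noteq> w" by auto
  have le1: "edge_mods n w w1 \<le> x - n + 2"
    using single_double_le[OF w1(2) assms(2)] assms(3,4) edge_mods_commute[of n w w1] by simp
  note lo = lower_double[OF assms(2-4,1)]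
  show ?thesis
  proof (cases "x = 2 * n - 1")
    case True
    \<comment> \<open>A shift would merge the internal zero with the final one; the all-one word is
      the competitor instead.\<close>
    obtain w2 where w2: "w2 \<in> codec_range n" "zeros_at n w2 {}"
      using zeros_at_exists[of n "{}"] n by auto
    have "zero_at n w2 (2 * n) \<noteq> zero_at n w (2 * n)" using w2(2) assms by (simp add: zeros_at_def)
    then have "w2 \<noteq> w" by auto
    moreover have "edge_mods n w w2 \<le> 4"
      using none_le[OF n w2(2), of w] assms(2) True edge_mods_commute[of n w w2] by simp
    ultimately show ?thesis using True lo by (intro minVM_eqI[OF w2(1)]) auto
  next
    case False
    obtain w2 where w2: "w2 \<in> codec_range n" "zeros_at n w2 {x + 1, 2 * n}"
      using zeros_at_exists[of n "{x + 1, 2 * n}"] assms(3,4) n by auto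
    have "zero_at n w2 x \<noteq> zero_at n w x" using w2(2) assms by (simp add: zeros_at_def)
    then have ne2: "w2 \<noteq> w" by auto
    have le2: "edge_mods n w w2 \<le> 2 * n + 2 - x"
      using double_shift_le[OF assms(2) w2(2)] assms(3,4) False by simp
    show ?thesis
    proof (cases "x - n + 2 \<le> 2 * n + 2 - x")
      case True
      then show ?thesis using le1 False lo by (intro minVM_eqI[OF w1(1) ne1]) auto
    next
      case False
      then show ?thesis using le2 \<open>x \<noteq> _\<close> lo by (intro minVM_eqI[OF w2(1) ne2]) auto
    qed
  qed
qed

lemma minVM_three:
  assumes "w \<in> codec_range n" "zero_at n w u" "zero_at n w v" "n < u" "u < v" "v < 2 * n"
  shows "minVM n w = 3"
proof -
  have n: "1 \<le> n" using assms by simp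
  have x: "first_zero n w \<le> u" using first_zero(5)[OF assms(2)] .
  then have "next_zero n w (first_zero n w) \<le> v"
    using next_zero(6)[of "first_zero n w" n v w] assms by simp
  then have xy: "first_zero n w < 2 * n" "next_zero n w (first_zero n w) < 2 * n" using x assms by auto
  \<comment> \<open>The zeros of \<open>w\<close> with its last digit flipped.\<close>
  define Z where "Z = {z. n < z \<and> z < 2 * n \<and> zero_at n w z} \<union> (if zero_at n w (2 * n) then {} else {2 * n})"
  have "Z \<subseteq> {n + 2..}"
  proof
    fix z assume "z \<in> Z"
    then have "zero_at n w z \<or> z = 2 * n" by (auto simp: Z_def split: if_splits)
    then have "first_zero n w \<le> z" using first_zero(5)[of n w z] xy(1) by auto
    then show "z \<in> {n + 2..}" using first_zero_gt[OF n assms(1)] by simp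
  qed
  then obtain w' where w': "w' \<in> codec_range n" "zeros_at n w' Z"
    using zeros_at_exists[OF n] by blast
  have agree: "zero_at n w z \<longleftrightarrow> zero_at n w' z" if "n < z" "z < 2 * n" for z
    using w'(2) that by (auto simp: zeros_at_def Z_def)
  have last: "zero_at n w' (2 * n) \<longleftrightarrow> \<not> zero_at n w (2 * n)"
    using w'(2) n by (auto simp: zeros_at_def Z_def)
  then have ne: "w' \<noteq> w" by auto
  have "edge_mods n w w' \<le> 3"
  proof (cases "zero_at n w (2 * n)")
    case True
    then show ?thesis using flip_last_le[OF n xy agree] last by simp
  next
    case False
    \<comment> \<open>\<open>flip_last_le\<close> wants the final zero in its first word, so the
      words trade places and the first two zeros are transferred to \<open>w'\<close>.\<close>
    let ?x = "first_zero n w"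
    have x': "first_zero n w' = ?x"
    proof (rule first_zero_eqI)
      show "zero_at n w' ?x" using agree[of ?x] first_zero(1,2)[of n w] xy(1) by simp
      show "\<not> zero_at n w' v" if "n < v" "v < ?x" for v
        using agree[of v] first_zero(4)[of v n w] that xy(1) by simp
    qed
    have "next_zero n w' ?x = next_zero n w ?x"
    proof (rule next_zero_eqI)
      show "zero_at n w' (next_zero n w ?x)" "?x < next_zero n w ?x"
        using agree[of "next_zero n w ?x"] next_zero(1,2,4)[of ?x n w] xy by simp_all
      show "\<not> zero_at n w' v" if "?x < v" "v < next_zero n w ?x" for v
        using agree[of v] next_zero(5)[of ?x n v w] that xy first_zero(2)[of n w] by simp
    qed
    then have "edge_mods n w' w \<le> 3"
      using flip_last_le[OF n, of w' w] agree last x' xy False by simp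
    then show ?thesis by (simp add: edge_mods_commute)
  qed
  then show ?thesis using lower_three[OF n xy assms(1)] by (intro minVM_eqI[OF w'(1) ne]) auto
qed

section \<open>From binary digits to zero positions\<close>

lemma upt_ends: "n \<ge> 2 \<Longrightarrow> [0..<n] = 0 # [1..<n - 1] @ [n - 1]"
  by (cases n) (auto simp: upt_conv_Cons)

lemma count_list_internal_block:
  assumes "n \<ge> 2"
  shows "count_list (internal_block n w) False = card {k. 1 \<le> k \<and> k < n - 1 \<and> \<not> bit w k}"
proof -
  have "internal_block n w = rev (map (bit w) [1..<n - 1])"
    by (simp add: internal_block_def bin_rep_def upt_ends[OF assms] butlast_append)
  then have "count_list (internal_block n w) False = length (filter (\<lambda>k. \<not> bit w k) [1..<n - 1])"
    by (simp add: count_list_eq_length_filter filter_map o_def rev_filter[symmetric])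
  also have "\<dots> = card (set (filter (\<lambda>k. \<not> bit w k) [1..<n - 1]))"
    by (rule distinct_card[symmetric]) simp
  also have "set (filter (\<lambda>k. \<not> bit w k) [1..<n - 1]) = {k. 1 \<le> k \<and> k < n - 1 \<and> \<not> bit w k}"
    by auto
  finally show ?thesis .
qed

lemma zero_at_bit: "k < n \<Longrightarrow> zero_at n w (2 * n - k) \<longleftrightarrow> \<not> bit w k"
  by (auto simp: zero_at_def one_at_def)

lemma zeros_at_bits:
  assumes "\<And>k. k < n \<Longrightarrow> bit w k \<longleftrightarrow> 2 * n - k \<notin> Z"
  shows "zeros_at n w Z"
  unfolding zeros_at_def
proof (intro allI impI)
  fix v assume v: "n < v" "v \<le> 2 * n"
  then show "zero_at n w v \<longleftrightarrow> v \<in> Z"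
    using assms[of "2 * n - v"] zero_at_bit[of "2 * n - v" n w] by simp
qed

text \<open>Between the leading digit and the zero of bit index \<open>k\<close> lie the bits from
  \<open>n - 2\<close> down to \<open>k + 1\<close>, and between it and the last digit the bits from
  \<open>k - 1\<close> down to 1. Hence \<open>l = n - 2 - k\<close> and
  \<open>r = k - 1\<close>.\<close>

lemma bin_rep_single:
  assumes "1 \<le> k" "k < n - 1" "\<not> bit w k" "\<And>j. 1 \<le> j \<Longrightarrow> j < n \<Longrightarrow> j \<noteq> k \<Longrightarrow> bit w j"
  shows "bin_rep n w = [True] @ replicate (n - 2 - k) True @ [False] @ replicate (k - 1) True @ [bit w 0]"
proof -
  have "[1..<n - 1] = [1..<k] @ k # [Suc k..<n - 1]"
    using assms(1,2) by (metis less_imp_le_nat upt_add_eq_append upt_conv_Cons le_Suc_ex)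
  then have "[0..<n] = 0 # [1..<k] @ k # [Suc k..<n - 1] @ [n - 1]"
    using upt_ends[of n] assms(1,2) by simp
  moreover have "map (bit w) [1..<k] = replicate (k - 1) True"
    using assms(2,4) by (intro replicate_eqI) auto
  moreover have "map (bit w) [Suc k..<n - 1] = replicate (n - 2 - k) True"
    using assms(4) by (intro replicate_eqI) auto
  moreover have "bit w (n - 1)" using assms(1,2,4) by simp
  ultimately have "map (bit w) [0..<n] =
      [bit w 0] @ replicate (k - 1) True @ [False] @ replicate (n - 2 - k) True @ [True]"
    using assms(3) by simp
  then show ?thesis by (simp add: bin_rep_def)
qed

theorem theorem1:
  fixes n w :: nat
  assumes "n \<ge> 2" and "w \<in> codec_range n"
  shows "(count_list (internal_block n w) False \<ge> 2 \<longrightarrow> minVM n w = 3) \<and>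
    (count_list (internal_block n w) False = 1 \<longrightarrow>
      (\<exists>l r b. bin_rep n w = [True] @ replicate l True @ [False] @ replicate r True @ [b] \<and>
        (\<not> b \<and> r > 0 \<longrightarrow> minVM n w = 4 + min l (r - 1)) \<and>
        (\<not> b \<and> r = 0 \<longrightarrow> minVM n w = 4) \<and>
        (b \<longrightarrow> minVM n w = 4 + min l r))) \<and>
    (n \<ge> 4 \<and> count_list (internal_block n w) False = 0 \<longrightarrow> minVM n w = 4)"
proof -
  define K where "K = {k. 1 \<le> k \<and> k < n - 1 \<and> \<not> bit w k}"
  have count: "count_list (internal_block n w) False = card K"
    using count_list_internal_block[OF assms(1)] by (simp add: K_def)
  have fin: "finite K" by (simp add: K_def)
  have top: "bit w (n - 1)" using assms by (simp add: codec_range_bits)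
  have bits: "bit w k" if "1 \<le> k" "k < n" "k \<notin> K" for k
    using that top by (cases "k = n - 1") (auto simp: K_def)
  have two: "minVM n w = 3" if two: "2 \<le> card K"
  proof -
    obtain T where T: "T \<subseteq> K" "card T = 2" using obtain_subset_with_card_n[OF two] by metis
    then obtain c d where cd: "c \<in> K" "d \<in> K" "c \<noteq> d" by (auto simp: card_2_iff)
    \<comment> \<open>Positions decrease as bit indices grow, so the larger index \<open>b\<close>
      gives the earlier zero.\<close>
    define a b where "a = min c d" and "b = max c d"
    have "a \<in> K" "b \<in> K" "a < b" using cd by (auto simp: a_def b_def min_def max_def)
    then have "zero_at n w (2 * n - b)" "zero_at n w (2 * n - a)" "n < 2 * n - b" "2 * n - b < 2 * n - a"
      "2 * n - a < 2 * n"
      by (auto simp: K_def zero_at_bit)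
    then show ?thesis by (rule minVM_three[OF assms(2)])
  qed
  have single: "\<exists>l r b. bin_rep n w = [True] @ replicate l True @ [False] @ replicate r True @ [b] \<and>
        (\<not> b \<and> r > 0 \<longrightarrow> minVM n w = 4 + min l (r - 1)) \<and>
        (\<not> b \<and> r = 0 \<longrightarrow> minVM n w = 4) \<and>
        (b \<longrightarrow> minVM n w = 4 + min l r)" if K1: "card K = 1"
  proof -
    obtain k where k: "K = {k}" using K1 by (rule card_1_singletonE)
    then have "k \<in> K" by simp
    then have kb: "1 \<le> k" "k < n - 1" "\<not> bit w k" by (auto simp: K_def)
    have others: "bit w j" if "1 \<le> j" "j < n" "j \<noteq> k" for j using bits[of j] that k by simp
    let ?x = "2 * n - k"
    have x: "n + 1 < ?x" "?x < 2 * n" using kb by auto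
    have b1: "minVM n w = 4 + min (n - 2 - k) (k - 1)" if b: "bit w 0"
    proof -
      have "zeros_at n w {?x}"
      proof (rule zeros_at_bits)
        show "bit w j \<longleftrightarrow> 2 * n - j \<notin> {?x}" if "j < n" for j
          using that b kb others[of j] by (cases "j = 0"; cases "j = k") auto
      qed
      then have "minVM n w = min (?x - n + 2) (2 * n + 3 - ?x)"
        using x by (rule minVM_single[OF assms(2)])
      moreover have "?x - n + 2 = 4 + (n - 2 - k)" "2 * n + 3 - ?x = 4 + (k - 1)" using kb(1,2) by auto
      ultimately show ?thesis by (simp only: min_add_distrib_right)
    qed
    have b0: "minVM n w = (if k = 1 then 4 else 4 + min (n - 2 - k) (k - 1 - 1))" if b: "\<not> bit w 0"
    proof -
      have "zeros_at n w {?x, 2 * n}"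
      proof (rule zeros_at_bits)
        show "bit w j \<longleftrightarrow> 2 * n - j \<notin> {?x, 2 * n}" if "j < n" for j
          using that b kb others[of j] by (cases "j = 0"; cases "j = k") auto
      qed
      then have "minVM n w = (if ?x = 2 * n - 1 then 4 else min (?x - n + 2) (2 * n + 2 - ?x))"
        using x by (rule minVM_double[OF assms(2)])
      \<comment> \<open>The condition \<open>k = 1\<close> is \<open>r = 0\<close>: the internal
        zero is adjacent to the last digit.\<close>
      moreover have "?x = 2 * n - 1 \<longleftrightarrow> k = 1" using kb(1,2) by auto
      moreover have "?x - n + 2 = 4 + (n - 2 - k)" using kb(1,2) by auto
      moreover have "2 * n + 2 - ?x = 4 + (k - 1 - 1)" if "k \<noteq> 1" using that kb(1,2) by auto
      ultimately show ?thesis 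
        by (cases "k = 1") (simp_all only: min_add_distrib_right if_True if_False simp_thms)
    qed
    show ?thesis
    proof (intro exI conjI)
      show "bin_rep n w = [True] @ replicate (n - 2 - k) True @ [False] @ replicate (k - 1) True @ [bit w 0]"
        using kb others by (rule bin_rep_single)
      show "\<not> bit w 0 \<and> k - 1 > 0 \<longrightarrow> minVM n w = 4 + min (n - 2 - k) (k - 1 - 1)"
        using b0 by simp
      show "\<not> bit w 0 \<and> k - 1 = 0 \<longrightarrow> minVM n w = 4" using b0 kb(1) by simp
      show "bit w 0 \<longrightarrow> minVM n w = 4 + min (n - 2 - k) (k - 1)" using b1 by simp
    qed
  qed
  have none: "minVM n w = 4" if "4 \<le> n" "card K = 0"
  proof -
    have "K = {}" using that(2) fin by simp
    then have ones: "bit w j" if "1 \<le> j" "j < n" for j using bits[of j] that by simp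
    show ?thesis
    proof (cases "bit w 0")
      case True
      have "zeros_at n w {}"
      proof (rule zeros_at_bits)
        show "bit w j \<longleftrightarrow> 2 * n - j \<notin> {}" if "j < n" for j
          using that True ones[of j] by (cases "j = 0") auto
      qed
      then show ?thesis by (rule minVM_none[OF that(1) assms(2)])
    next
      case False
      have "zeros_at n w {2 * n}"
      proof (rule zeros_at_bits)
        show "bit w j \<longleftrightarrow> 2 * n - j \<notin> {2 * n}" if "j < n" for j
          using that False ones[of j] by (cases "j = 0") auto
      qed
      then show ?thesis by (rule minVM_last[OF that(1) assms(2)])
    qed
  qed
  show ?thesis
    unfolding count
  proof (intro conjI)
    show "2 \<le> card K \<longrightarrow> minVM n w = 3" using two by (rule impI)
    show "4 \<le> n \<and> card K = 0 \<longrightarrow> minVM n w = 4" using none by simp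
  qed (rule impI, rule single)
qed

end
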